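(* Let $(\mathscr{A},\mathscr{E})$ be a weakly idempotent complete exact category. Consider a morphism from a short exact sequence $A'\to A\to A''$ to a short exact sequence $B'\to B\to B''$ whose components $\alpha':A'\to B'$, $\alpha:A\to B$, $\alpha'':A''\to B''$ are admissible morphisms. Then there is a commutative diagram $$\begin{array}{ccccc} K' & \xrightarrow{k} & K & \xrightarrow{k'} & K''\\ \downarrow & & \downarrow & & \downarrow\\ A' & \to & A & \to & A''\\ {\scriptstyle \alpha'}\downarrow & & {\scriptstyle \alpha}\downarrow & & {\scriptstyle \alpha''}\downarrow\\ B' & \to & B & \to & B''\\ \downarrow & & \downarrow & & \downarrow\\ C' & \xrightarrow{c} & C & \xrightarrow{c'} & C''\end{array}$$ with exact rows and columns, in which the morphisms $K'\to A'$, $K\to A$, $K''\to A''$ are admissible monics and $B'\to C'$, $B\to C$, $B''\to C''$ are admissible epics (so these are kernels and cokernels of $\alpha',\alpha,\alpha''$, respectively), and there is a connecting morphism $\delta:K''\to C'$ fitting into an exact sequence $$K'\xrightarrow{k}K\xrightarrow{k'}K''\xrightarrow{\delta}C'\xrightarrow{c}C\xrightarrow{c'}C''$$ of admissible morphisms, in which $k$ is an admissible monic and $c'$ is an admissible epic, depending naturally on the morphism of short exact sequences.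
   Context: A kernel-cokernel pair in an additive category $\mathscr{A}$ is a pair of composable morphisms $A'\xrightarrow{i}A\xrightarrow{p}A''$ such that $i$ is a kernel of $p$ and $p$ is a cokernel of $i$. Given a class $\mathscr{E}$ of kernel-cokernel pairs, an admissible monic is a morphism $i$ for which there is $p$ with $(i,p)\in\mathscr{E}$; an admissible epic is a morphism $p$ for which there is $i$ with $(i,p)\in\mathscr{E}$. An exact structure on $\mathscr{A}$ is a class $\mathscr{E}$ of kernel-cokernel pairs closed under isomorphisms such that: all identity morphisms are admissible monics and admissible epics; admissible monics are closed under composition and admissible epics are closed under composition; the push-out of an admissible monic along an arbitrary morphism exists and yields an admissible monic; the pull-back of an admissible epic along an arbitrary morphism exists and yields an admissible epic. An exact category is a pair $(\mathscr{A},\mathscr{E})$ of an additive category and an exact structure on it; elements of $\mathscr{E}$ are called short exact sequences. An additive category is weakly idempotent complete if every retraction (morphism $r$ with $rs=1$ for some $s$) has a kernel; equivalently, every coretraction (morphism $c$ with $sc=1$ for some $s$) has a cokernel. A morphism $f$ in an exact category is admissible if it factors as $f=me$ with $e$ an admissible epic and $m$ an admissible monic; this factorization is unique up to unique isomorphism, and an admissible morphism has a kernel (an admissible monic) and a cokernel (an admissible epic). A sequence of admissible morphisms $A'\xrightarrow{f}A\xrightarrow{f'}A''$ with factorizations $f=me$, $m:I\to A$, and $f'=m'e'$, $e':A\to I'$, is exact if $I\xrightarrow{m}A\xrightarrow{e'}I'$ is short exact (in $\mathscr{E}$). Longer sequences of admissible morphisms are exact if any two consecutive morphisms form an exact sequence.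 *)

theory Defs
  imports "HOL-Algebra.Group"
begin

section \<open>Additive categories\<close>

text \<open>Every arrow carries its own source and target.  Composition is written in the usual order
  (first the right factor), and it and the addition are only meaningful on composable and on
  parallel arrows, respectively; \<open>Zer C A B\<close> is the zero arrow from \<open>A\<close> to \<open>B\<close>.\<close>

record ('o, 'm) precat =
  Obj :: "'o set"
  Arr :: "'m set"
  Src :: "'m \<Rightarrow> 'o"
  Tgt :: "'m \<Rightarrow> 'o"
  Ide :: "'o \<Rightarrow> 'm"
  Cmp :: "'m \<Rightarrow> 'm \<Rightarrow> 'm" (infixl \<open>\<cdot>\<index>\<close> 70)
  Add :: "'m \<Rightarrow> 'm \<Rightarrow> 'm"
  Zer :: "'o \<Rightarrow> 'o \<Rightarrow> 'm"

definition Hom :: "('o, 'm, 'z) precat_scheme \<Rightarrow> 'o \<Rightarrow> 'o \<Rightarrow> 'm set" where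
  "Hom C A B = {f \<in> Arr C. Src C f = A \<and> Tgt C f = B}"

definition hom_group :: "('o, 'm, 'z) precat_scheme \<Rightarrow> 'o \<Rightarrow> 'o \<Rightarrow> 'm monoid" where
  "hom_group C A B = \<lparr>carrier = Hom C A B, mult = Add C, one = Zer C A B\<rparr>"

locale category =
  fixes C :: "('o, 'm, 'z) precat_scheme" (structure)
  assumes src_obj: "f \<in> Arr C \<Longrightarrow> Src C f \<in> Obj C"
    and tgt_obj: "f \<in> Arr C \<Longrightarrow> Tgt C f \<in> Obj C"
    and ide_hom: "A \<in> Obj C \<Longrightarrow> Ide C A \<in> Hom C A A"
    and cmp_hom: "f \<in> Hom C A B \<Longrightarrow> g \<in> Hom C B D \<Longrightarrow> g \<cdot> f \<in> Hom C A D"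
    and ide_left: "f \<in> Hom C A B \<Longrightarrow> Ide C B \<cdot> f = f"
    and ide_right: "f \<in> Hom C A B \<Longrightarrow> f \<cdot> Ide C A = f"
    and cmp_assoc: "f \<in> Hom C A B \<Longrightarrow> g \<in> Hom C B D \<Longrightarrow> h \<in> Hom C D F \<Longrightarrow>
      (h \<cdot> g) \<cdot> f = h \<cdot> (g \<cdot> f)"

locale preadditive_category = category C
  for C :: "('o, 'm, 'z) precat_scheme" (structure) +
  assumes hom_comm_group: "A \<in> Obj C \<Longrightarrow> B \<in> Obj C \<Longrightarrow> comm_group (hom_group C A B)"
    and cmp_add_right: "f \<in> Hom C A B \<Longrightarrow> g \<in> Hom C A B \<Longrightarrow> h \<in> Hom C B D \<Longrightarrow>
      h \<cdot> (Add C f g) = Add C (h \<cdot> f) (h \<cdot> g)"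
    and cmp_add_left: "f \<in> Hom C A B \<Longrightarrow> g \<in> Hom C B D \<Longrightarrow> h \<in> Hom C B D \<Longrightarrow>
      (Add C g h) \<cdot> f = Add C (g \<cdot> f) (h \<cdot> f)"

definition is_zero_object :: "('o, 'm, 'z) precat_scheme \<Rightarrow> 'o \<Rightarrow> bool" where
  "is_zero_object C Z \<longleftrightarrow> Z \<in> Obj C \<and>
     (\<forall>A \<in> Obj C. (\<exists>!f. f \<in> Hom C A Z) \<and> (\<exists>!f. f \<in> Hom C Z A))"

definition is_biproduct ::
  "('o, 'm, 'z) precat_scheme \<Rightarrow> 'o \<Rightarrow> 'o \<Rightarrow> 'o \<Rightarrow> 'm \<Rightarrow> 'm \<Rightarrow> 'm \<Rightarrow> 'm \<Rightarrow> bool" where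
  "is_biproduct C A B P i\<^sub>A i\<^sub>B p\<^sub>A p\<^sub>B \<longleftrightarrow>
     i\<^sub>A \<in> Hom C A P \<and> i\<^sub>B \<in> Hom C B P \<and> p\<^sub>A \<in> Hom C P A \<and> p\<^sub>B \<in> Hom C P B \<and>
     p\<^sub>A \<cdot>\<^bsub>C\<^esub> i\<^sub>A = Ide C A \<and> p\<^sub>B \<cdot>\<^bsub>C\<^esub> i\<^sub>B = Ide C B \<and>
     p\<^sub>B \<cdot>\<^bsub>C\<^esub> i\<^sub>A = Zer C A B \<and> p\<^sub>A \<cdot>\<^bsub>C\<^esub> i\<^sub>B = Zer C B A \<and>
     Add C (i\<^sub>A \<cdot>\<^bsub>C\<^esub> p\<^sub>A) (i\<^sub>B \<cdot>\<^bsub>C\<^esub> p\<^sub>B) = Ide C P"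

locale additive_category = preadditive_category C
  for C :: "('o, 'm, 'z) precat_scheme" (structure) +
  assumes zero_object: "\<exists>Z. is_zero_object C Z"
    and biproducts: "A \<in> Obj C \<Longrightarrow> B \<in> Obj C \<Longrightarrow>
      \<exists>P i\<^sub>A i\<^sub>B p\<^sub>A p\<^sub>B. is_biproduct C A B P i\<^sub>A i\<^sub>B p\<^sub>A p\<^sub>B"

definition is_iso :: "('o, 'm, 'z) precat_scheme \<Rightarrow> 'm \<Rightarrow> bool" where
  "is_iso C f \<longleftrightarrow> f \<in> Arr C \<and>
     (\<exists>g \<in> Hom C (Tgt C f) (Src C f).
        g \<cdot>\<^bsub>C\<^esub> f = Ide C (Src C f) \<and> f \<cdot>\<^bsub>C\<^esub> g = Ide C (Tgt C f))"

definition is_kernel :: "('o, 'm, 'z) precat_scheme \<Rightarrow> 'm \<Rightarrow> 'm \<Rightarrow> bool" where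
  "is_kernel C k f \<longleftrightarrow> f \<in> Arr C \<and> k \<in> Arr C \<and> Tgt C k = Src C f \<and>
     f \<cdot>\<^bsub>C\<^esub> k = Zer C (Src C k) (Tgt C f) \<and>
     (\<forall>x \<in> Arr C. Tgt C x = Src C f \<longrightarrow> f \<cdot>\<^bsub>C\<^esub> x = Zer C (Src C x) (Tgt C f) \<longrightarrow>
        (\<exists>!u. u \<in> Hom C (Src C x) (Src C k) \<and> k \<cdot>\<^bsub>C\<^esub> u = x))"

definition is_cokernel :: "('o, 'm, 'z) precat_scheme \<Rightarrow> 'm \<Rightarrow> 'm \<Rightarrow> bool" where
  "is_cokernel C c f \<longleftrightarrow> f \<in> Arr C \<and> c \<in> Arr C \<and> Src C c = Tgt C f \<and>
     c \<cdot>\<^bsub>C\<^esub> f = Zer C (Src C f) (Tgt C c) \<and>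
     (\<forall>x \<in> Arr C. Src C x = Tgt C f \<longrightarrow> x \<cdot>\<^bsub>C\<^esub> f = Zer C (Src C f) (Tgt C x) \<longrightarrow>
        (\<exists>!u. u \<in> Hom C (Tgt C c) (Tgt C x) \<and> u \<cdot>\<^bsub>C\<^esub> c = x))"

definition is_retraction :: "('o, 'm, 'z) precat_scheme \<Rightarrow> 'm \<Rightarrow> bool" where
  "is_retraction C r \<longleftrightarrow> r \<in> Arr C \<and>
     (\<exists>s \<in> Hom C (Tgt C r) (Src C r). r \<cdot>\<^bsub>C\<^esub> s = Ide C (Tgt C r))"

definition weakly_idempotent_complete :: "('o, 'm, 'z) precat_scheme \<Rightarrow> bool" where
  "weakly_idempotent_complete C \<longleftrightarrow> (\<forall>r. is_retraction C r \<longrightarrow> (\<exists>k. is_kernel C k r))"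

text \<open>The square with sides \<open>i : A \<rightarrow> B\<close>, \<open>f : A \<rightarrow> A'\<close>, \<open>i' : A' \<rightarrow> B'\<close>, \<open>f' : B \<rightarrow> B'\<close>;
  \<open>i'\<close> is the push-out of \<open>i\<close> along \<open>f\<close>.\<close>

definition is_pushout :: "('o, 'm, 'z) precat_scheme \<Rightarrow> 'm \<Rightarrow> 'm \<Rightarrow> 'm \<Rightarrow> 'm \<Rightarrow> bool" where
  "is_pushout C i f i' f' \<longleftrightarrow>
     i \<in> Arr C \<and> f \<in> Arr C \<and> i' \<in> Arr C \<and> f' \<in> Arr C \<and>
     Src C f = Src C i \<and> Src C i' = Tgt C f \<and> Src C f' = Tgt C i \<and> Tgt C f' = Tgt C i' \<and>
     i' \<cdot>\<^bsub>C\<^esub> f = f' \<cdot>\<^bsub>C\<^esub> i \<and>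
     (\<forall>x \<in> Arr C. \<forall>y \<in> Arr C.
        Src C x = Tgt C f \<longrightarrow> Src C y = Tgt C i \<longrightarrow> Tgt C x = Tgt C y \<longrightarrow>
        x \<cdot>\<^bsub>C\<^esub> f = y \<cdot>\<^bsub>C\<^esub> i \<longrightarrow>
        (\<exists>!u. u \<in> Hom C (Tgt C i') (Tgt C x) \<and> u \<cdot>\<^bsub>C\<^esub> i' = x \<and> u \<cdot>\<^bsub>C\<^esub> f' = y))"

text \<open>The square with sides \<open>p : A \<rightarrow> B\<close>, \<open>f : B' \<rightarrow> B\<close>, \<open>p' : A' \<rightarrow> B'\<close>, \<open>f' : A' \<rightarrow> A\<close>;
  \<open>p'\<close> is the pull-back of \<open>p\<close> along \<open>f\<close>.\<close>

definition is_pullback :: "('o, 'm, 'z) precat_scheme \<Rightarrow> 'm \<Rightarrow> 'm \<Rightarrow> 'm \<Rightarrow> 'm \<Rightarrow> bool" where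
  "is_pullback C p f p' f' \<longleftrightarrow>
     p \<in> Arr C \<and> f \<in> Arr C \<and> p' \<in> Arr C \<and> f' \<in> Arr C \<and>
     Tgt C f = Tgt C p \<and> Tgt C p' = Src C f \<and> Tgt C f' = Src C p \<and> Src C f' = Src C p' \<and>
     f \<cdot>\<^bsub>C\<^esub> p' = p \<cdot>\<^bsub>C\<^esub> f' \<and>
     (\<forall>x \<in> Arr C. \<forall>y \<in> Arr C.
        Tgt C x = Src C f \<longrightarrow> Tgt C y = Src C p \<longrightarrow> Src C x = Src C y \<longrightarrow>
        f \<cdot>\<^bsub>C\<^esub> x = p \<cdot>\<^bsub>C\<^esub> y \<longrightarrow>
        (\<exists>!u. u \<in> Hom C (Src C x) (Src C p') \<and> p' \<cdot>\<^bsub>C\<^esub> u = x \<and> f' \<cdot>\<^bsub>C\<^esub> u = y))"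


section \<open>Exact categories\<close>

definition kernel_cokernel_pair :: "('o, 'm, 'z) precat_scheme \<Rightarrow> 'm \<times> 'm \<Rightarrow> bool" where
  "kernel_cokernel_pair C s \<longleftrightarrow> is_kernel C (fst s) (snd s) \<and> is_cokernel C (snd s) (fst s)"

text \<open>Morphisms \<open>(f', f, f'')\<close> between pairs of composable arrows
  \<open>s = (A' \<rightarrow> A, A \<rightarrow> A'')\<close> and \<open>t = (B' \<rightarrow> B, B \<rightarrow> B'')\<close>.\<close>

definition pair_morphism ::
  "('o, 'm, 'z) precat_scheme \<Rightarrow> 'm \<times> 'm \<Rightarrow> 'm \<times> 'm \<Rightarrow> 'm \<Rightarrow> 'm \<Rightarrow> 'm \<Rightarrow> bool" where
  "pair_morphism C s t f' f f'' \<longleftrightarrow>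
     f' \<in> Hom C (Src C (fst s)) (Src C (fst t)) \<and>
     f \<in> Hom C (Tgt C (fst s)) (Tgt C (fst t)) \<and>
     f'' \<in> Hom C (Tgt C (snd s)) (Tgt C (snd t)) \<and>
     f \<cdot>\<^bsub>C\<^esub> fst s = fst t \<cdot>\<^bsub>C\<^esub> f' \<and>
     f'' \<cdot>\<^bsub>C\<^esub> snd s = snd t \<cdot>\<^bsub>C\<^esub> f"

definition adm_monic :: "('m \<times> 'm) set \<Rightarrow> 'm \<Rightarrow> bool" where
  "adm_monic E i \<longleftrightarrow> (\<exists>p. (i, p) \<in> E)"

definition adm_epic :: "('m \<times> 'm) set \<Rightarrow> 'm \<Rightarrow> bool" where
  "adm_epic E p \<longleftrightarrow> (\<exists>i. (i, p) \<in> E)"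

locale exact_category = additive_category C
  for C :: "('o, 'm, 'z) precat_scheme" (structure) +
  fixes E :: "('m \<times> 'm) set"
  assumes kernel_cokernel: "s \<in> E \<Longrightarrow> kernel_cokernel_pair C s"
    and iso_closed: "s \<in> E \<Longrightarrow> kernel_cokernel_pair C t \<Longrightarrow> pair_morphism C s t f' f f'' \<Longrightarrow>
      is_iso C f' \<Longrightarrow> is_iso C f \<Longrightarrow> is_iso C f'' \<Longrightarrow> t \<in> E"
    and ide_monic: "A \<in> Obj C \<Longrightarrow> adm_monic E (Ide C A)"
    and ide_epic: "A \<in> Obj C \<Longrightarrow> adm_epic E (Ide C A)"
    and monic_cmp: "adm_monic E i \<Longrightarrow> adm_monic E j \<Longrightarrow> Src C j = Tgt C i \<Longrightarrow> adm_monic E (j \<cdot> i)"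
    and epic_cmp: "adm_epic E p \<Longrightarrow> adm_epic E q \<Longrightarrow> Src C q = Tgt C p \<Longrightarrow> adm_epic E (q \<cdot> p)"
    and monic_pushout: "adm_monic E i \<Longrightarrow> f \<in> Arr C \<Longrightarrow> Src C f = Src C i \<Longrightarrow>
      \<exists>i' f'. is_pushout C i f i' f' \<and> adm_monic E i'"
    and epic_pullback: "adm_epic E p \<Longrightarrow> f \<in> Arr C \<Longrightarrow> Tgt C f = Tgt C p \<Longrightarrow>
      \<exists>p' f'. is_pullback C p f p' f' \<and> adm_epic E p'"

definition adm_factorization ::
  "('o, 'm, 'z) precat_scheme \<Rightarrow> ('m \<times> 'm) set \<Rightarrow> 'm \<Rightarrow> 'm \<Rightarrow> 'm \<Rightarrow> bool" where
  "adm_factorization C E f e m \<longleftrightarrow>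
     adm_epic E e \<and> adm_monic E m \<and> Tgt C e = Src C m \<and> f = m \<cdot>\<^bsub>C\<^esub> e"

definition admissible :: "('o, 'm, 'z) precat_scheme \<Rightarrow> ('m \<times> 'm) set \<Rightarrow> 'm \<Rightarrow> bool" where
  "admissible C E f \<longleftrightarrow> (\<exists>e m. adm_factorization C E f e m)"

text \<open>As the factorizations are unique up to unique isomorphism and \<open>E\<close> is closed under isomorphisms,
  exactness does not depend on their choice.\<close>

definition exact_pair :: "('o, 'm, 'z) precat_scheme \<Rightarrow> ('m \<times> 'm) set \<Rightarrow> 'm \<Rightarrow> 'm \<Rightarrow> bool" where
  "exact_pair C E f f' \<longleftrightarrow>
     (\<exists>e m e' m'. adm_factorization C E f e m \<and> adm_factorization C E f' e' m' \<and> (m, e') \<in> E)"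

definition exact_sequence :: "('o, 'm, 'z) precat_scheme \<Rightarrow> ('m \<times> 'm) set \<Rightarrow> 'm list \<Rightarrow> bool" where
  "exact_sequence C E fs \<longleftrightarrow>
     (\<forall>f \<in> set fs. admissible C E f) \<and>
     (\<forall>n. Suc n < length fs \<longrightarrow> exact_pair C E (fs ! n) (fs ! Suc n))"


section \<open>Morphisms of short exact sequences and snake diagrams\<close>

record 'm ses_map =
  top_seq :: "'m \<times> 'm"
  bot_seq :: "'m \<times> 'm"
  left_map :: 'm
  mid_map :: 'm
  right_map :: 'm

definition adm_ses_map ::
  "('o, 'm, 'z) precat_scheme \<Rightarrow> ('m \<times> 'm) set \<Rightarrow> 'm ses_map \<Rightarrow> bool" where
  "adm_ses_map C E \<phi> \<longleftrightarrow>
     top_seq \<phi> \<in> E \<and> bot_seq \<phi> \<in> E \<and>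
     pair_morphism C (top_seq \<phi>) (bot_seq \<phi>) (left_map \<phi>) (mid_map \<phi>) (right_map \<phi>) \<and>
     admissible C E (left_map \<phi>) \<and> admissible C E (mid_map \<phi>) \<and> admissible C E (right_map \<phi>)"

text \<open>The data added to a morphism of short exact sequences: the arrows \<open>K' \<rightarrow> A'\<close>, \<open>K \<rightarrow> A\<close>,
  \<open>K'' \<rightarrow> A''\<close>, then \<open>B' \<rightarrow> C'\<close>, \<open>B \<rightarrow> C\<close>, \<open>B'' \<rightarrow> C''\<close>, and the six-term sequence
  \<open>k\<close>, \<open>k'\<close>, \<open>\<delta>\<close>, \<open>c\<close>, \<open>c'\<close>.  The objects are the sources and targets of these arrows.\<close>

record 'm snake =
  ker_left :: 'm
  ker_mid :: 'm
  ker_right :: 'm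
  coker_left :: 'm
  coker_mid :: 'm
  coker_right :: 'm
  ker_map :: 'm
  ker_map' :: 'm
  connecting :: 'm
  coker_map :: 'm
  coker_map' :: 'm

definition ker_row :: "'m snake \<Rightarrow> 'm \<times> 'm" where
  "ker_row S = (ker_map S, ker_map' S)"

definition coker_row :: "'m snake \<Rightarrow> 'm \<times> 'm" where
  "coker_row S = (coker_map S, coker_map' S)"

definition snake_column ::
  "('o, 'm, 'z) precat_scheme \<Rightarrow> ('m \<times> 'm) set \<Rightarrow> 'm \<Rightarrow> 'm \<Rightarrow> 'm \<Rightarrow> bool" where
  "snake_column C E \<iota> \<alpha> \<pi> \<longleftrightarrow>
     exact_sequence C E [\<iota>, \<alpha>, \<pi>] \<and> adm_monic E \<iota> \<and> adm_epic E \<pi> \<and>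
     is_kernel C \<iota> \<alpha> \<and> is_cokernel C \<pi> \<alpha>"

text \<open>The two \<open>pair_morphism\<close> clauses give the commutativity of the upper and the lower squares and
  fix the sources and targets of the arrows involved; the middle squares commute by
  \<open>adm_ses_map\<close>.\<close>

definition snake_diagram ::
  "('o, 'm, 'z) precat_scheme \<Rightarrow> ('m \<times> 'm) set \<Rightarrow> 'm ses_map \<Rightarrow> 'm snake \<Rightarrow> bool" where
  "snake_diagram C E \<phi> S \<longleftrightarrow>
     snake_column C E (ker_left S) (left_map \<phi>) (coker_left S) \<and>
     snake_column C E (ker_mid S) (mid_map \<phi>) (coker_mid S) \<and>
     snake_column C E (ker_right S) (right_map \<phi>) (coker_right S) \<and>
     ker_map S \<in> Hom C (Src C (ker_left S)) (Src C (ker_mid S)) \<and>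
     ker_map' S \<in> Hom C (Src C (ker_mid S)) (Src C (ker_right S)) \<and>
     coker_map S \<in> Hom C (Tgt C (coker_left S)) (Tgt C (coker_mid S)) \<and>
     coker_map' S \<in> Hom C (Tgt C (coker_mid S)) (Tgt C (coker_right S)) \<and>
     pair_morphism C (ker_row S) (top_seq \<phi>) (ker_left S) (ker_mid S) (ker_right S) \<and>
     pair_morphism C (bot_seq \<phi>) (coker_row S) (coker_left S) (coker_mid S) (coker_right S) \<and>
     exact_sequence C E [ker_map S, ker_map' S] \<and>
     exact_sequence C E [coker_map S, coker_map' S]"

definition snake_sequence ::
  "('o, 'm, 'z) precat_scheme \<Rightarrow> ('m \<times> 'm) set \<Rightarrow> 'm snake \<Rightarrow> bool" where
  "snake_sequence C E S \<longleftrightarrow>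
     connecting S \<in> Hom C (Src C (ker_right S)) (Tgt C (coker_left S)) \<and>
     exact_sequence C E [ker_map S, ker_map' S, connecting S, coker_map S, coker_map' S] \<and>
     adm_monic E (ker_map S) \<and> adm_epic E (coker_map' S)"

text \<open>A morphism \<open>\<phi> \<rightarrow> \<psi>\<close> between morphisms of short exact sequences is a commutative diagram made of
  a morphism \<open>(a', a, a'')\<close> of the upper and a morphism \<open>(b', b, b'')\<close> of the lower sequences.\<close>

definition ses_map_morphism ::
  "('o, 'm, 'z) precat_scheme \<Rightarrow> 'm ses_map \<Rightarrow> 'm ses_map \<Rightarrow>
    'm \<Rightarrow> 'm \<Rightarrow> 'm \<Rightarrow> 'm \<Rightarrow> 'm \<Rightarrow> 'm \<Rightarrow> bool" where
  "ses_map_morphism C \<phi> \<psi> a' a a'' b' b b'' \<longleftrightarrow>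
     pair_morphism C (top_seq \<phi>) (top_seq \<psi>) a' a a'' \<and>
     pair_morphism C (bot_seq \<phi>) (bot_seq \<psi>) b' b b'' \<and>
     b' \<cdot>\<^bsub>C\<^esub> left_map \<phi> = left_map \<psi> \<cdot>\<^bsub>C\<^esub> a' \<and>
     b \<cdot>\<^bsub>C\<^esub> mid_map \<phi> = mid_map \<psi> \<cdot>\<^bsub>C\<^esub> a \<and>
     b'' \<cdot>\<^bsub>C\<^esub> right_map \<phi> = right_map \<psi> \<cdot>\<^bsub>C\<^esub> a''"

text \<open>The maps induced on kernels and on cokernels (necessarily unique) form a morphism of six-term
  sequences; the square involving the connecting morphisms is the last clause.\<close>

definition snake_natural ::
  "('o, 'm, 'z) precat_scheme \<Rightarrow> 'm snake \<Rightarrow> 'm snake \<Rightarrow>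
    'm \<Rightarrow> 'm \<Rightarrow> 'm \<Rightarrow> 'm \<Rightarrow> 'm \<Rightarrow> 'm \<Rightarrow> bool" where
  "snake_natural C S T a' a a'' b' b b'' \<longleftrightarrow>
     (\<exists>\<kappa>' \<kappa> \<kappa>'' \<gamma>' \<gamma> \<gamma>''.
        pair_morphism C (ker_row S) (ker_row T) \<kappa>' \<kappa> \<kappa>'' \<and>
        pair_morphism C (coker_row S) (coker_row T) \<gamma>' \<gamma> \<gamma>'' \<and>
        ker_left T \<cdot>\<^bsub>C\<^esub> \<kappa>' = a' \<cdot>\<^bsub>C\<^esub> ker_left S \<and>
        ker_mid T \<cdot>\<^bsub>C\<^esub> \<kappa> = a \<cdot>\<^bsub>C\<^esub> ker_mid S \<and>
        ker_right T \<cdot>\<^bsub>C\<^esub> \<kappa>'' = a'' \<cdot>\<^bsub>C\<^esub> ker_right S \<and>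
        \<gamma>' \<cdot>\<^bsub>C\<^esub> coker_left S = coker_left T \<cdot>\<^bsub>C\<^esub> b' \<and>
        \<gamma> \<cdot>\<^bsub>C\<^esub> coker_mid S = coker_mid T \<cdot>\<^bsub>C\<^esub> b \<and>
        \<gamma>'' \<cdot>\<^bsub>C\<^esub> coker_right S = coker_right T \<cdot>\<^bsub>C\<^esub> b'' \<and>
        \<gamma>' \<cdot>\<^bsub>C\<^esub> connecting S = connecting T \<cdot>\<^bsub>C\<^esub> \<kappa>'')"

end

theory Submission
  imports Defs
begin

text \<open>Diagram chases are done with generalized elements \<open>x : T \<rightarrow> A\<close>, where an element may be
  replaced by its restriction along an admissible epic \<open>T' \<rightarrow> T\<close>.  Elements lift locally along
  admissible epics because these are stable under pull-back.  Conversely, in a weakly idempotent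
  complete exact category \<open>g\<close> is an admissible epic as soon as some \<open>g \<cdot> f\<close> is, so a morphism along
  which all elements lift locally is an admissible epic; in particular, if \<open>g\<close> is admissible,
  \<open>g \<cdot> f = 0\<close> and every element killed by \<open>g\<close> lifts locally along \<open>f\<close>, then \<open>f\<close> is admissible and
  \<open>f, g\<close> is exact.  Applied from right to left, this turns the usual element chase into a proof that
  the six-term sequence is an exact sequence of admissible morphisms.  The connecting morphism
  \<open>\<delta>\<close> is characterized by the zig-zag \<open>\<delta> x = [b]\<close> whenever \<open>x\<close> lifts to an element \<open>a\<close> of \<open>A\<close> whose
  image in \<open>B\<close> comes from \<open>b\<close> in \<open>B'\<close>, which makes naturality immediate.\<close>

section \<open>Calculus of arrows\<close>

lemma Hom_iff: "f \<in> Hom C A B \<longleftrightarrow> f \<in> Arr C \<and> Src C f = A \<and> Tgt C f = B"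
  by (simp add: Hom_def)

context category
begin

lemma hom_self [simp]: "f \<in> Arr C \<Longrightarrow> f \<in> Hom C (Src C f) (Tgt C f)"
  by (simp add: Hom_iff)

lemma hom_obj: "f \<in> Hom C A B \<Longrightarrow> A \<in> Obj C \<and> B \<in> Obj C"
  using src_obj tgt_obj by (auto simp: Hom_iff)

lemma ide_simps [simp]:
  assumes "A \<in> Obj C"
  shows "Ide C A \<in> Arr C" "Src C (Ide C A) = A" "Tgt C (Ide C A) = A"
  using ide_hom[OF assms] by (auto simp: Hom_iff)

lemma cmp_simps [simp]:
  assumes "f \<in> Arr C" "g \<in> Arr C" "Src C g = Tgt C f"
  shows "g \<cdot> f \<in> Arr C" "Src C (g \<cdot> f) = Src C f" "Tgt C (g \<cdot> f) = Tgt C g"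
  using cmp_hom[of f "Src C f" "Tgt C f" g "Tgt C g"] assms by (auto simp: Hom_iff)

lemma assoc [simp]:
  assumes "f \<in> Arr C" "g \<in> Arr C" "h \<in> Arr C" "Src C g = Tgt C f" "Src C h = Tgt C g"
  shows "(h \<cdot> g) \<cdot> f = h \<cdot> (g \<cdot> f)"
  using cmp_assoc[of f "Src C f" "Tgt C f" g "Tgt C g" h "Tgt C h"] assms by (auto simp: Hom_iff)

lemma ide_cmp [simp]:
  assumes "f \<in> Arr C"
  shows "Tgt C f = A \<Longrightarrow> Ide C A \<cdot> f = f" "Src C f = A \<Longrightarrow> f \<cdot> Ide C A = f"
  using ide_left ide_right hom_self[OF assms] by auto

text \<open>Commutative squares enter the element chases in this form. Associativity holds only for
  composable arrows, so the \<open>Hom\<close> facts are passed explicitly instead of being found by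
  the simplifier.\<close>

lemma cmp_square:
  assumes "g \<cdot> f = g' \<cdot> f'" "f \<in> Hom C A B" "g \<in> Hom C B D" "f' \<in> Hom C A B'" "g' \<in> Hom C B' D"
    "x \<in> Hom C T A"
  shows "g \<cdot> (f \<cdot> x) = g' \<cdot> (f' \<cdot> x)"
  using cmp_assoc[OF assms(6,2,3)] cmp_assoc[OF assms(6,4,5)] assms(1) by simp

lemma cmp_pull:
  assumes "g \<cdot> f = h" "f \<in> Hom C A B" "g \<in> Hom C B D" "x \<in> Hom C T A"
  shows "g \<cdot> (f \<cdot> x) = h \<cdot> x"
  using cmp_assoc[OF assms(4,2,3)] assms(1) by simp

lemma is_isoI:
  assumes "f \<in> Hom C A B" "g \<in> Hom C B A" "g \<cdot> f = Ide C A" "f \<cdot> g = Ide C B"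
  shows "is_iso C f"
  unfolding is_iso_def using assms by (intro conjI bexI[of _ g]) (simp_all add: Hom_iff)

lemma is_iso_ide: "A \<in> Obj C \<Longrightarrow> is_iso C (Ide C A)"
  by (rule is_isoI[where g = "Ide C A"]) (auto simp: Hom_iff)

end

section \<open>Differences and zero arrows\<close>

context preadditive_category
begin

text \<open>Subtraction of parallel arrows, needed to correct lifts in the chases. The group in
  which \<open>g\<close> is inverted is read off from \<open>f\<close>, so no objects have to be
  passed.\<close>

definition diff :: "'m \<Rightarrow> 'm \<Rightarrow> 'm" where
  "diff f g = Add C f (m_inv (hom_group C (Src C f) (Tgt C f)) g)"

lemma hom_group_simps [simp]:
  "carrier (hom_group C A B) = Hom C A B" "mult (hom_group C A B) = Add C"
  "one (hom_group C A B) = Zer C A B"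
  by (auto simp: hom_group_def)

lemma
  assumes "A \<in> Obj C" "B \<in> Obj C"
  shows zer_hom: "Zer C A B \<in> Hom C A B"
    and zer_simps [simp]: "Zer C A B \<in> Arr C" "Src C (Zer C A B) = A" "Tgt C (Zer C A B) = B"
proof -
  interpret comm_group "hom_group C A B" using hom_comm_group[OF assms] .
  show "Zer C A B \<in> Hom C A B" using one_closed by simp
  then show "Zer C A B \<in> Arr C" "Src C (Zer C A B) = A" "Tgt C (Zer C A B) = B"
    by (auto simp: Hom_iff)
qed

lemma
  assumes "f \<in> Hom C A B" "g \<in> Hom C A B"
  shows add_hom: "Add C f g \<in> Hom C A B"
    and diff_hom: "diff f g \<in> Hom C A B"
    and diff_add: "Add C (diff f g) g = f"
    and diff_self: "diff f f = Zer C A B"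
    and diff_zer_right: "diff f (Zer C A B) = f"
    and add_zer_left: "Add C (Zer C A B) f = f"
    and add_zer_right: "Add C f (Zer C A B) = f"
    and diff_eqI: "h \<in> Hom C A B \<Longrightarrow> Add C h g = f \<Longrightarrow> diff f g = h"
    and add_eq_self: "Add C f g = g \<Longrightarrow> f = Zer C A B"
proof -
  interpret comm_group "hom_group C A B"
    using hom_comm_group hom_obj[OF assms(1)] by blast
  have m: "diff f h = f \<otimes>\<^bsub>hom_group C A B\<^esub> inv\<^bsub>hom_group C A B\<^esub> h" for h
    using assms by (auto simp: diff_def Hom_iff)
  have c: "f \<in> carrier (hom_group C A B)" "g \<in> carrier (hom_group C A B)" using assms by auto
  show "Add C f g \<in> Hom C A B" using m_closed[OF c] by simp
  show "diff f g \<in> Hom C A B" using m_closed[OF c(1) inv_closed[OF c(2)]] m by simp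
  show "Add C (diff f g) g = f"
    using m_assoc[OF c(1) inv_closed[OF c(2)] c(2)] c m l_inv r_one by simp
  show "diff f f = Zer C A B" using m r_inv[OF c(1)] by simp
  show "diff f (Zer C A B) = f" using m inv_one r_one[OF c(1)] by simp
  show "Add C (Zer C A B) f = f" using l_one[OF c(1)] by simp
  show "Add C f (Zer C A B) = f" using r_one[OF c(1)] by simp
  show "diff f g = h" if "h \<in> Hom C A B" "Add C h g = f"
    using that m[of g] c m_assoc[of h g "inv\<^bsub>hom_group C A B\<^esub> g"] r_inv[OF c(2)] r_one[of h]
      inv_closed[OF c(2)] by simp
  show "f = Zer C A B" if "Add C f g = g"
    using that c r_cancel_one by simp
qed

lemma add_simps [simp]:
  assumes "f \<in> Arr C" "g \<in> Arr C" "Src C f = Src C g" "Tgt C f = Tgt C g"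
  shows "Add C f g \<in> Arr C" "Src C (Add C f g) = Src C g" "Tgt C (Add C f g) = Tgt C g"
    "diff f g \<in> Arr C" "Src C (diff f g) = Src C g" "Tgt C (diff f g) = Tgt C g"
  using add_hom[of f "Src C g" "Tgt C g" g] diff_hom[of f "Src C g" "Tgt C g" g] assms
  by (auto simp: Hom_iff)

text \<open>By distributivity the composite \<open>f \<cdot> 0\<close> equals its own double, and in
  a group this forces it to be neutral.\<close>

lemma cmp_zer_right [simp]:
  assumes "f \<in> Arr C" "Src C f = B" "A \<in> Obj C"
  shows "f \<cdot> Zer C A B = Zer C A (Tgt C f)"
proof -
  have f: "f \<in> Hom C B (Tgt C f)" "B \<in> Obj C" using assms src_obj by (auto simp: Hom_iff)
  have z: "Zer C A B \<in> Hom C A B" using zer_hom assms(3) f by auto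
  have "f \<cdot> Zer C A B = Add C (f \<cdot> Zer C A B) (f \<cdot> Zer C A B)"
    using cmp_add_right[OF z z f(1)] add_zer_left[OF z z] by simp
  then show ?thesis using add_eq_self cmp_hom[OF z f(1)] by metis
qed

lemma cmp_zer_left [simp]:
  assumes "f \<in> Arr C" "Tgt C f = A" "B \<in> Obj C"
  shows "Zer C A B \<cdot> f = Zer C (Src C f) B"
proof -
  have f: "f \<in> Hom C (Src C f) A" "A \<in> Obj C" using assms tgt_obj by (auto simp: Hom_iff)
  have z: "Zer C A B \<in> Hom C A B" using zer_hom assms(3) f by auto
  have "Zer C A B \<cdot> f = Add C (Zer C A B \<cdot> f) (Zer C A B \<cdot> f)"
    using cmp_add_left[OF f(1) z z] add_zer_left[OF z z] by simp
  then show ?thesis using add_eq_self cmp_hom[OF f(1) z] by metis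
qed

lemma cmp_zer:
  assumes "f \<in> Hom C A B" "D \<in> Obj C"
  shows "f \<cdot> Zer C D A = Zer C D B" "Zer C B D \<cdot> f = Zer C A D"
  using assms by (simp_all add: Hom_iff)

lemma cmp_pull_zer:
  assumes "g \<cdot> f = Zer C A D" "f \<in> Hom C A B" "g \<in> Hom C B D" "x \<in> Hom C T A"
  shows "g \<cdot> (f \<cdot> x) = Zer C T D"
  using cmp_pull[OF assms] cmp_zer(2)[OF assms(4)] hom_obj[OF assms(3)] by simp

lemma cmp_diff_right:
  assumes f: "f \<in> Hom C A B" and g: "g \<in> Hom C A B" and h: "h \<in> Hom C B D"
  shows "h \<cdot> diff f g = diff (h \<cdot> f) (h \<cdot> g)"
proof -
  have "Add C (h \<cdot> diff f g) (h \<cdot> g) = h \<cdot> f"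
    using cmp_add_right[OF diff_hom[OF f g] g h] diff_add[OF f g] by simp
  then show ?thesis
    using diff_eqI[OF cmp_hom[OF f h] cmp_hom[OF g h] cmp_hom[OF diff_hom[OF f g] h]] by simp
qed

lemma cmp_diff_left:
  assumes f: "f \<in> Hom C A B" and g: "g \<in> Hom C A B" and h: "h \<in> Hom C D A"
  shows "diff f g \<cdot> h = diff (f \<cdot> h) (g \<cdot> h)"
proof -
  have "Add C (diff f g \<cdot> h) (g \<cdot> h) = f \<cdot> h"
    using cmp_add_left[OF h diff_hom[OF f g] g] diff_add[OF f g] by simp
  then show ?thesis
    using diff_eqI[OF cmp_hom[OF h f] cmp_hom[OF h g] cmp_hom[OF h diff_hom[OF f g]]] by simp
qed

section \<open>Universal properties with named objects and \<open>Hom\<close> membership\<close>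

lemma pushoutE:
  assumes "is_pushout C i f j g"
  obtains A B K P where "i \<in> Hom C A B" "f \<in> Hom C A K" "j \<in> Hom C K P" "g \<in> Hom C B P"
    "j \<cdot> f = g \<cdot> i"
    "\<And>T x y. x \<in> Hom C K T \<Longrightarrow> y \<in> Hom C B T \<Longrightarrow> x \<cdot> f = y \<cdot> i \<Longrightarrow>
      \<exists>!u. u \<in> Hom C P T \<and> u \<cdot> j = x \<and> u \<cdot> g = y"
proof -
  have a: "i \<in> Arr C" "f \<in> Arr C" "j \<in> Arr C" "g \<in> Arr C"
    and s: "Src C f = Src C i" "Src C j = Tgt C f" "Src C g = Tgt C i" "Tgt C g = Tgt C j"
    and e: "j \<cdot> f = g \<cdot> i"
    using assms by (simp_all add: is_pushout_def)
  have univ: "\<forall>x \<in> Arr C. \<forall>y \<in> Arr C.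
      Src C x = Tgt C f \<longrightarrow> Src C y = Tgt C i \<longrightarrow> Tgt C x = Tgt C y \<longrightarrow> x \<cdot> f = y \<cdot> i \<longrightarrow>
      (\<exists>!u. u \<in> Hom C (Tgt C j) (Tgt C x) \<and> u \<cdot> j = x \<and> u \<cdot> g = y)"
    using assms unfolding is_pushout_def by (elim conjE)
  show thesis
  proof (rule that[of "Src C i" "Tgt C i" "Tgt C f" "Tgt C j"])
    fix T x y
    assume x: "x \<in> Hom C (Tgt C f) T" and y: "y \<in> Hom C (Tgt C i) T" and xy: "x \<cdot> f = y \<cdot> i"
    have t: "x \<in> Arr C" "y \<in> Arr C" "Src C x = Tgt C f" "Src C y = Tgt C i" "Tgt C x = T"
      "Tgt C y = T"
      using x y by (auto simp: Hom_iff)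
    show "\<exists>!u. u \<in> Hom C (Tgt C j) T \<and> u \<cdot> j = x \<and> u \<cdot> g = y"
      using bspec[OF bspec[OF univ t(1)] t(2)] t(3-6) xy by simp
  qed (use a s e in \<open>simp_all add: Hom_iff\<close>)
qed

lemma pullbackE:
  assumes "is_pullback C p f q g"
  obtains A B K P where "p \<in> Hom C A B" "f \<in> Hom C K B" "q \<in> Hom C P K" "g \<in> Hom C P A"
    "f \<cdot> q = p \<cdot> g"
    "\<And>T x y. x \<in> Hom C T K \<Longrightarrow> y \<in> Hom C T A \<Longrightarrow> f \<cdot> x = p \<cdot> y \<Longrightarrow>
      \<exists>!u. u \<in> Hom C T P \<and> q \<cdot> u = x \<and> g \<cdot> u = y"
proof -
  have a: "p \<in> Arr C" "f \<in> Arr C" "q \<in> Arr C" "g \<in> Arr C"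
    and s: "Tgt C f = Tgt C p" "Tgt C q = Src C f" "Tgt C g = Src C p" "Src C g = Src C q"
    and e: "f \<cdot> q = p \<cdot> g"
    using assms by (simp_all add: is_pullback_def)
  have univ: "\<forall>x \<in> Arr C. \<forall>y \<in> Arr C.
      Tgt C x = Src C f \<longrightarrow> Tgt C y = Src C p \<longrightarrow> Src C x = Src C y \<longrightarrow> f \<cdot> x = p \<cdot> y \<longrightarrow>
      (\<exists>!u. u \<in> Hom C (Src C x) (Src C q) \<and> q \<cdot> u = x \<and> g \<cdot> u = y)"
    using assms unfolding is_pullback_def by (elim conjE)
  show thesis
  proof (rule that[of "Src C p" "Tgt C p" "Src C f" "Src C q"])
    fix T x y
    assume x: "x \<in> Hom C T (Src C f)" and y: "y \<in> Hom C T (Src C p)" and xy: "f \<cdot> x = p \<cdot> y"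
    have t: "x \<in> Arr C" "y \<in> Arr C" "Tgt C x = Src C f" "Tgt C y = Src C p" "Src C x = T"
      "Src C y = T"
      using x y by (auto simp: Hom_iff)
    show "\<exists>!u. u \<in> Hom C T (Src C q) \<and> q \<cdot> u = x \<and> g \<cdot> u = y"
      using bspec[OF bspec[OF univ t(1)] t(2)] t(3-6) xy by simp
  qed (use a s e in \<open>simp_all add: Hom_iff\<close>)
qed

text \<open>Splits the unique existence into existence and joint cancellation of the two legs, since
  the applications obtain these from different sources.\<close>

lemma pullbackI:
  assumes "p \<in> Hom C A B" "f \<in> Hom C K B" "q \<in> Hom C P K" "g \<in> Hom C P A" "f \<cdot> q = p \<cdot> g"
    and ex: "\<And>T x y. x \<in> Hom C T K \<Longrightarrow> y \<in> Hom C T A \<Longrightarrow> f \<cdot> x = p \<cdot> y \<Longrightarrow>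
      \<exists>u \<in> Hom C T P. q \<cdot> u = x \<and> g \<cdot> u = y"
    and unique: "\<And>T u v. u \<in> Hom C T P \<Longrightarrow> v \<in> Hom C T P \<Longrightarrow> q \<cdot> u = q \<cdot> v \<Longrightarrow> g \<cdot> u = g \<cdot> v \<Longrightarrow>
      u = v"
  shows "is_pullback C p f q g"
  unfolding is_pullback_def
proof (intro conjI ballI impI)
  fix x y assume t: "x \<in> Arr C" "y \<in> Arr C" "Tgt C x = Src C f" "Tgt C y = Src C p"
    "Src C x = Src C y" and xy: "f \<cdot> x = p \<cdot> y"
  have "\<exists>u \<in> Hom C (Src C x) P. q \<cdot> u = x \<and> g \<cdot> u = y"
    by (rule ex) (use t xy assms(1,2) in \<open>simp_all add: Hom_iff\<close>)
  then obtain u where u: "u \<in> Hom C (Src C x) P" "q \<cdot> u = x" "g \<cdot> u = y" by blast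
  have q: "Src C q = P" using assms(3) by (simp add: Hom_iff)
  show "\<exists>!u. u \<in> Hom C (Src C x) (Src C q) \<and> q \<cdot> u = x \<and> g \<cdot> u = y"
    unfolding q by (rule ex1I[of _ u]) (simp_all add: u unique[OF _ u(1)])
qed (use assms(1-5) in \<open>simp_all add: Hom_iff\<close>)

lemma pushoutI:
  assumes "i \<in> Hom C A B" "f \<in> Hom C A K" "j \<in> Hom C K P" "g \<in> Hom C B P" "j \<cdot> f = g \<cdot> i"
    and ex: "\<And>T x y. x \<in> Hom C K T \<Longrightarrow> y \<in> Hom C B T \<Longrightarrow> x \<cdot> f = y \<cdot> i \<Longrightarrow>
      \<exists>u \<in> Hom C P T. u \<cdot> j = x \<and> u \<cdot> g = y"
    and unique: "\<And>T u v. u \<in> Hom C P T \<Longrightarrow> v \<in> Hom C P T \<Longrightarrow> u \<cdot> j = v \<cdot> j \<Longrightarrow> u \<cdot> g = v \<cdot> g \<Longrightarrow>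
      u = v"
  shows "is_pushout C i f j g"
  unfolding is_pushout_def
proof (intro conjI ballI impI)
  fix x y assume t: "x \<in> Arr C" "y \<in> Arr C" "Src C x = Tgt C f" "Src C y = Tgt C i"
    "Tgt C x = Tgt C y" and xy: "x \<cdot> f = y \<cdot> i"
  have "\<exists>u \<in> Hom C P (Tgt C x). u \<cdot> j = x \<and> u \<cdot> g = y"
    by (rule ex) (use t xy assms(1,2) in \<open>simp_all add: Hom_iff\<close>)
  then obtain u where u: "u \<in> Hom C P (Tgt C x)" "u \<cdot> j = x" "u \<cdot> g = y" by blast
  have j: "Tgt C j = P" using assms(3) by (simp add: Hom_iff)
  show "\<exists>!u. u \<in> Hom C (Tgt C j) (Tgt C x) \<and> u \<cdot> j = x \<and> u \<cdot> g = y"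
    unfolding j by (rule ex1I[of _ u]) (simp_all add: u unique[OF _ u(1)])
qed (use assms(1-5) in \<open>simp_all add: Hom_iff\<close>)

lemma kernelI:
  assumes "k \<in> Hom C K A" "f \<in> Hom C A B" "f \<cdot> k = Zer C K B"
    and "\<And>T x. x \<in> Hom C T A \<Longrightarrow> f \<cdot> x = Zer C T B \<Longrightarrow> \<exists>u \<in> Hom C T K. k \<cdot> u = x"
    and "\<And>T u v. u \<in> Hom C T K \<Longrightarrow> v \<in> Hom C T K \<Longrightarrow> k \<cdot> u = k \<cdot> v \<Longrightarrow> u = v"
  shows "is_kernel C k f"
  unfolding is_kernel_def
proof (intro conjI ballI impI)
  fix x assume x: "x \<in> Arr C" "Tgt C x = Src C f" "f \<cdot> x = Zer C (Src C x) (Tgt C f)"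
  have "\<exists>u \<in> Hom C (Src C x) K. k \<cdot> u = x"
    by (rule assms(4)) (use x assms(1,2) in \<open>simp_all add: Hom_iff\<close>)
  then obtain u where u: "u \<in> Hom C (Src C x) K" "k \<cdot> u = x" by blast
  have k: "Src C k = K" using assms(1) by (simp add: Hom_iff)
  show "\<exists>!u. u \<in> Hom C (Src C x) (Src C k) \<and> k \<cdot> u = x"
    unfolding k by (rule ex1I[of _ u]) (simp_all add: u assms(5)[OF _ u(1)])
qed (use assms(1-3) in \<open>simp_all add: Hom_iff\<close>)

lemma cokernelI:
  assumes "c \<in> Hom C B D" "f \<in> Hom C A B" "c \<cdot> f = Zer C A D"
    and "\<And>T x. x \<in> Hom C B T \<Longrightarrow> x \<cdot> f = Zer C A T \<Longrightarrow> \<exists>u \<in> Hom C D T. u \<cdot> c = x"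
    and "\<And>T u v. u \<in> Hom C D T \<Longrightarrow> v \<in> Hom C D T \<Longrightarrow> u \<cdot> c = v \<cdot> c \<Longrightarrow> u = v"
  shows "is_cokernel C c f"
  unfolding is_cokernel_def
proof (intro conjI ballI impI)
  fix x assume x: "x \<in> Arr C" "Src C x = Tgt C f" "x \<cdot> f = Zer C (Src C f) (Tgt C x)"
  have "\<exists>u \<in> Hom C D (Tgt C x). u \<cdot> c = x"
    by (rule assms(4)) (use x assms(1,2) in \<open>simp_all add: Hom_iff\<close>)
  then obtain u where u: "u \<in> Hom C D (Tgt C x)" "u \<cdot> c = x" by blast
  have c: "Tgt C c = D" using assms(1) by (simp add: Hom_iff)
  show "\<exists>!u. u \<in> Hom C (Tgt C c) (Tgt C x) \<and> u \<cdot> c = x"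
    unfolding c by (rule ex1I[of _ u]) (simp_all add: u assms(5)[OF _ u(1)])
qed (use assms(1-3) in \<open>simp_all add: Hom_iff\<close>)

lemma kernelD:
  assumes "is_kernel C k f"
  shows "f \<in> Arr C" "k \<in> Arr C" "Tgt C k = Src C f" "f \<cdot> k = Zer C (Src C k) (Tgt C f)"
  using assms unfolding is_kernel_def by simp_all

lemma cokernelD:
  assumes "is_cokernel C c f"
  shows "f \<in> Arr C" "c \<in> Arr C" "Src C c = Tgt C f" "c \<cdot> f = Zer C (Src C f) (Tgt C c)"
  using assms unfolding is_cokernel_def by simp_all

lemma kernel_ex1:
  assumes "is_kernel C k f" "x \<in> Hom C T (Src C f)" "f \<cdot> x = Zer C T (Tgt C f)"
  shows "\<exists>!u. u \<in> Hom C T (Src C k) \<and> k \<cdot> u = x"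
proof -
  have x: "x \<in> Arr C" "Tgt C x = Src C f" "Src C x = T" using assms(2) by (auto simp: Hom_iff)
  have "\<forall>x \<in> Arr C. Tgt C x = Src C f \<longrightarrow> f \<cdot> x = Zer C (Src C x) (Tgt C f) \<longrightarrow>
      (\<exists>!u. u \<in> Hom C (Src C x) (Src C k) \<and> k \<cdot> u = x)"
    using assms(1) unfolding is_kernel_def by (elim conjE)
  from bspec[OF this x(1)] show ?thesis using x assms(3) by simp
qed

lemma cokernel_ex1:
  assumes "is_cokernel C c f" "x \<in> Hom C (Tgt C f) T" "x \<cdot> f = Zer C (Src C f) T"
  shows "\<exists>!u. u \<in> Hom C (Tgt C c) T \<and> u \<cdot> c = x"
proof -
  have x: "x \<in> Arr C" "Src C x = Tgt C f" "Tgt C x = T" using assms(2) by (auto simp: Hom_iff)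
  have "\<forall>x \<in> Arr C. Src C x = Tgt C f \<longrightarrow> x \<cdot> f = Zer C (Src C f) (Tgt C x) \<longrightarrow>
      (\<exists>!u. u \<in> Hom C (Tgt C c) (Tgt C x) \<and> u \<cdot> c = x)"
    using assms(1) unfolding is_cokernel_def by (elim conjE)
  from bspec[OF this x(1)] show ?thesis using x assms(3) by simp
qed

lemma kernel_lift:
  assumes "is_kernel C k f" "k \<in> Hom C K A" "f \<in> Hom C A B" "x \<in> Hom C T A" "f \<cdot> x = Zer C T B"
  obtains u where "u \<in> Hom C T K" "k \<cdot> u = x"
proof -
  have s: "Src C k = K" "Src C f = A" "Tgt C f = B" using assms(2,3) by (auto simp: Hom_iff)
  show thesis using kernel_ex1[of k f x T, unfolded s, OF assms(1,4,5)] that by blast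
qed

text \<open>The arrow \<open>k \<cdot> u\<close> is killed by \<open>f\<close>, and \<open>u\<close>
  and \<open>v\<close> are two factorizations of it through \<open>k\<close>; the universal property
  allows only one.\<close>

lemma kernel_monic:
  assumes "is_kernel C k f" "k \<in> Hom C K A" "u \<in> Hom C T K" "v \<in> Hom C T K" "k \<cdot> u = k \<cdot> v"
  shows "u = v"
proof -
  have k: "f \<in> Arr C" "k \<in> Arr C" "Tgt C k = Src C f" "Src C k = K"
    "f \<cdot> k = Zer C K (Tgt C f)"
    using kernelD[OF assms(1)] assms(2) by (simp_all add: Hom_iff)
  have x: "k \<cdot> u \<in> Hom C T (Src C f)" using assms(3) k by (simp add: Hom_iff)
  have "f \<cdot> (k \<cdot> u) = (f \<cdot> k) \<cdot> u" using k(1-4) assms(3) by (simp add: Hom_iff)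
  also have "\<dots> = Zer C T (Tgt C f)" using k assms(3) tgt_obj[of f] by (simp add: Hom_iff)
  finally show ?thesis using kernel_ex1[OF assms(1) x, unfolded k(4)] assms(3-5) by metis
qed

lemma cokernel_lift:
  assumes "is_cokernel C c f" "c \<in> Hom C B D" "f \<in> Hom C A B" "x \<in> Hom C B T"
    "x \<cdot> f = Zer C A T"
  obtains u where "u \<in> Hom C D T" "u \<cdot> c = x"
proof -
  have s: "Tgt C c = D" "Src C f = A" "Tgt C f = B" using assms(2,3) by (auto simp: Hom_iff)
  show thesis using cokernel_ex1[of c f x T, unfolded s, OF assms(1,4,5)] that by blast
qed

lemma cokernel_epic:
  assumes "is_cokernel C c f" "c \<in> Hom C B D" "u \<in> Hom C D T" "v \<in> Hom C D T" "u \<cdot> c = v \<cdot> c"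
  shows "u = v"
proof -
  have k: "f \<in> Arr C" "c \<in> Arr C" "Src C c = Tgt C f" "Tgt C c = D"
    "c \<cdot> f = Zer C (Src C f) D"
    using cokernelD[OF assms(1)] assms(2) by (simp_all add: Hom_iff)
  have x: "u \<cdot> c \<in> Hom C (Tgt C f) T" using assms(3) k by (simp add: Hom_iff)
  have "(u \<cdot> c) \<cdot> f = Zer C (Src C f) T" using k assms(3) src_obj[of f] by (simp add: Hom_iff)
  then show ?thesis using cokernel_ex1[OF assms(1) x, unfolded k(4)] assms(3-5) by metis
qed

text \<open>The arrow \<open>a \<cdot> k\<close> is killed by \<open>g\<close>, because the square
  turns \<open>g \<cdot> a \<cdot> k\<close> into \<open>b \<cdot> f \<cdot> k\<close>. This
  provides both the row of kernels of a snake and the maps of kernels in the naturality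
  statement.\<close>

lemma kernel_map:
  assumes kg: "is_kernel C l g" and l: "l \<in> Hom C L A'" and g: "g \<in> Hom C A' B'"
    and k: "k \<in> Hom C K A" and f: "f \<in> Hom C A B" and fk: "f \<cdot> k = Zer C K B"
    and a: "a \<in> Hom C A A'" and b: "b \<in> Hom C B B'" and sq: "b \<cdot> f = g \<cdot> a"
  obtains u where "u \<in> Hom C K L" "l \<cdot> u = a \<cdot> k"
proof -
  have "g \<cdot> (a \<cdot> k) = b \<cdot> (f \<cdot> k)" using cmp_square[OF sq f b a g k] by simp
  also have "\<dots> = Zer C K B'" using fk cmp_zer(1)[OF b] hom_obj[OF k] by simp
  finally show thesis using kernel_lift[OF kg l g cmp_hom[OF k a]] that by blast
qed

lemma cokernel_map:
  assumes cf: "is_cokernel C c f" and c: "c \<in> Hom C B Q" and f: "f \<in> Hom C A B"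
    and d: "d \<in> Hom C B' Q'" and g: "g \<in> Hom C A' B'" and dg: "d \<cdot> g = Zer C A' Q'"
    and a: "a \<in> Hom C A A'" and b: "b \<in> Hom C B B'" and sq: "b \<cdot> f = g \<cdot> a"
  obtains u where "u \<in> Hom C Q Q'" "u \<cdot> c = d \<cdot> b"
proof -
  have "(d \<cdot> b) \<cdot> f = d \<cdot> (g \<cdot> a)" using cmp_assoc[OF f b d] sq by simp
  also have "\<dots> = Zer C A Q'" using cmp_pull_zer[OF dg g d a] .
  finally show thesis using cokernel_lift[OF cf c f cmp_hom[OF b d]] that by blast
qed

text \<open>Each kernel factors through the other; after cancelling the kernels, both composites of
  the comparison maps become identities.\<close>

lemma kernel_unique_iso:
  assumes "is_kernel C k f" "is_kernel C l f"
  obtains u where "u \<in> Hom C (Src C k) (Src C l)" "l \<cdot> u = k" "is_iso C u"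
proof -
  define K L A B where d: "K = Src C k" "L = Src C l" "A = Src C f" "B = Tgt C f"
  have h: "k \<in> Hom C K A" "l \<in> Hom C L A" "f \<in> Hom C A B" "f \<cdot> k = Zer C K B" "f \<cdot> l = Zer C L B"
    using kernelD[OF assms(1)] kernelD[OF assms(2)] by (simp_all add: d Hom_iff)
  have o: "K \<in> Obj C" "L \<in> Obj C" using h hom_obj by auto
  obtain u where u: "u \<in> Hom C K L" "l \<cdot> u = k" using kernel_lift[OF assms(2) h(2,3,1,4)] .
  obtain v where v: "v \<in> Hom C L K" "k \<cdot> v = l" using kernel_lift[OF assms(1) h(1,3,2,5)] .
  have "k \<cdot> (v \<cdot> u) = k \<cdot> Ide C K"
    using cmp_pull[OF v(2,1) h(1) u(1)] u h by (simp add: Hom_iff)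
  then have "v \<cdot> u = Ide C K"
    by (rule kernel_monic[OF assms(1) h(1) cmp_hom[OF u(1) v(1)] ide_hom[OF o(1)]])
  moreover have "l \<cdot> (u \<cdot> v) = l \<cdot> Ide C L"
    using cmp_pull[OF u(2,1) h(2) v(1)] v h by (simp add: Hom_iff)
  then have "u \<cdot> v = Ide C L"
    by (rule kernel_monic[OF assms(2) h(2) cmp_hom[OF v(1) u(1)] ide_hom[OF o(2)]])
  ultimately have "is_iso C u" using is_isoI[OF u(1) v(1)] by blast
  then show thesis using that u unfolding d by blast
qed

lemma cokernel_unique_iso:
  assumes "is_cokernel C c f" "is_cokernel C d f"
  obtains u where "u \<in> Hom C (Tgt C c) (Tgt C d)" "u \<cdot> c = d" "is_iso C u"
proof -
  define K L A B where d: "K = Tgt C c" "L = Tgt C d" "A = Src C f" "B = Tgt C f"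
  have h: "c \<in> Hom C B K" "d \<in> Hom C B L" "f \<in> Hom C A B" "c \<cdot> f = Zer C A K" "d \<cdot> f = Zer C A L"
    using cokernelD[OF assms(1)] cokernelD[OF assms(2)] by (simp_all add: d Hom_iff)
  have o: "K \<in> Obj C" "L \<in> Obj C" using h hom_obj by auto
  obtain u where u: "u \<in> Hom C K L" "u \<cdot> c = d" using cokernel_lift[OF assms(1) h(1,3,2,5)] .
  obtain v where v: "v \<in> Hom C L K" "v \<cdot> d = c" using cokernel_lift[OF assms(2) h(2,3,1,4)] .
  have "(v \<cdot> u) \<cdot> c = Ide C K \<cdot> c" using u v h by (simp add: Hom_iff)
  then have "v \<cdot> u = Ide C K"
    by (rule cokernel_epic[OF assms(1) h(1) cmp_hom[OF u(1) v(1)] ide_hom[OF o(1)]])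
  moreover have "(u \<cdot> v) \<cdot> d = Ide C L \<cdot> d" using u v h by (simp add: Hom_iff)
  then have "u \<cdot> v = Ide C L"
    by (rule cokernel_epic[OF assms(2) h(2) cmp_hom[OF v(1) u(1)] ide_hom[OF o(2)]])
  ultimately have "is_iso C u" using is_isoI[OF u(1) v(1)] by blast
  then show thesis using that u unfolding d by blast
qed

end


section \<open>Admissible epics and monics\<close>

context exact_category
begin

section \<open>Short exact sequences and the choice of kernels and cokernels\<close>

lemma ses_homs:
  assumes "(i, p) \<in> E"
  obtains A' A A'' where "i \<in> Hom C A' A" "p \<in> Hom C A A''" "p \<cdot> i = Zer C A' A''"
    "is_kernel C i p" "is_cokernel C p i"
proof -
  have "is_kernel C i p" "is_cokernel C p i"
    using kernel_cokernel[OF assms] by (auto simp: kernel_cokernel_pair_def)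
  then show thesis
    using that[of "Src C i" "Src C p" "Tgt C p"] kernelD[of i p] by (simp add: Hom_iff)
qed

text \<open>Two kernels of \<open>p\<close> differ by an isomorphism and \<open>E\<close> is closed
  under isomorphisms. What has to be checked is that \<open>p\<close> is a cokernel of the new
  kernel as well.\<close>

lemma ses_kernel:
  assumes "(i, p) \<in> E" "is_kernel C j p"
  shows "(j, p) \<in> E"
proof -
  obtain A' A A'' where h: "i \<in> Hom C A' A" "p \<in> Hom C A A''" "p \<cdot> i = Zer C A' A''"
    and ik: "is_kernel C i p" and pc: "is_cokernel C p i" using ses_homs[OF assms(1)] .
  obtain u where u: "u \<in> Hom C (Src C i) (Src C j)" "j \<cdot> u = i" "is_iso C u"
    using kernel_unique_iso[OF ik assms(2)] .
  define J where J: "J = Src C j"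
  have j: "j \<in> Hom C J A" "p \<cdot> j = Zer C J A''" and u': "u \<in> Hom C A' J"
    using kernelD[OF assms(2)] h u by (simp_all add: Hom_iff J)
  have o: "A \<in> Obj C" "A'' \<in> Obj C" using h hom_obj by auto
  have "is_cokernel C p j"
  proof (rule cokernelI[OF h(2) j(1)])
    show "p \<cdot> j = Zer C J A''" by fact
    show "\<exists>v \<in> Hom C A'' T. v \<cdot> p = x" if x: "x \<in> Hom C A T" "x \<cdot> j = Zer C J T" for T x
    proof -
      have T: "T \<in> Obj C" using x hom_obj by auto
      have "x \<cdot> i = (x \<cdot> j) \<cdot> u" using cmp_assoc[OF u' j(1) x(1)] u(2) by simp
      also have "\<dots> = Zer C A' T" using x u' T by (simp add: Hom_iff)
      finally show ?thesis using cokernel_lift[OF pc h(2,1) x(1)] by blast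
    qed
  qed (use cokernel_epic[OF pc h(2)] in blast)
  then have "kernel_cokernel_pair C (j, p)" using assms(2) by (simp add: kernel_cokernel_pair_def)
  moreover have "pair_morphism C (i, p) (j, p) u (Ide C A) (Ide C A'')"
    using h j o u by (auto simp: pair_morphism_def Hom_iff)
  ultimately show ?thesis using iso_closed[OF assms(1)] u is_iso_ide o by blast
qed

lemma ses_cokernel:
  assumes "(i, p) \<in> E" "is_cokernel C q i"
  shows "(i, q) \<in> E"
proof -
  obtain A' A A'' where h: "i \<in> Hom C A' A" "p \<in> Hom C A A''" "p \<cdot> i = Zer C A' A''"
    and ik: "is_kernel C i p" and pc: "is_cokernel C p i" using ses_homs[OF assms(1)] .
  obtain u where u: "u \<in> Hom C (Tgt C p) (Tgt C q)" "u \<cdot> p = q" "is_iso C u"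
    using cokernel_unique_iso[OF pc assms(2)] .
  \<comment> \<open>Here the comparison is used in both directions: \<open>u\<close> carries
    \<open>(i, p)\<close> to \<open>(i, q)\<close>, whereas \<open>v\<close> shows that whatever
    \<open>q\<close> kills is also killed by \<open>p\<close>.\<close>
  obtain v where v: "v \<in> Hom C (Tgt C q) (Tgt C p)" "v \<cdot> q = p"
    using cokernel_unique_iso[OF assms(2) pc] .
  define Q where Q: "Q = Tgt C q"
  have q: "q \<in> Hom C A Q" "q \<cdot> i = Zer C A' Q" and u': "v \<in> Hom C Q A''"
    using cokernelD[OF assms(2)] h v by (simp_all add: Hom_iff Q)
  have o: "A' \<in> Obj C" "A \<in> Obj C" "A'' \<in> Obj C" using h hom_obj by auto
  have "is_kernel C i q"
  proof (rule kernelI[OF h(1) q(1)])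
    show "q \<cdot> i = Zer C A' Q" by fact
    show "\<exists>w \<in> Hom C T A'. i \<cdot> w = x" if x: "x \<in> Hom C T A" "q \<cdot> x = Zer C T Q" for T x
    proof -
      have T: "T \<in> Obj C" using x hom_obj by auto
      have "p \<cdot> x = v \<cdot> (q \<cdot> x)" using cmp_assoc[OF x(1) q(1) u'] v(2) by simp
      also have "\<dots> = Zer C T A''" using x u' T by (simp add: Hom_iff)
      finally show ?thesis using kernel_lift[OF ik h(1,2) x(1)] by blast
    qed
  qed (use kernel_monic[OF ik h(1)] in blast)
  then have "kernel_cokernel_pair C (i, q)" using assms(2) by (simp add: kernel_cokernel_pair_def)
  moreover have "pair_morphism C (i, p) (i, q) (Ide C A') (Ide C A) u"
    using h q o u by (auto simp: pair_morphism_def Hom_iff)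
  ultimately show ?thesis using iso_closed[OF assms(1)] u is_iso_ide o by blast
qed

lemma adm_epic_kernel:
  assumes "adm_epic E p" "is_kernel C j p"
  shows "(j, p) \<in> E"
  using assms ses_kernel unfolding adm_epic_def by blast

lemma adm_monic_cokernel:
  assumes "adm_monic E i" "is_cokernel C q i"
  shows "(i, q) \<in> E"
  using assms ses_cokernel unfolding adm_monic_def by blast

lemma adm_epic_arr [simp]:
  assumes "adm_epic E p"
  shows "p \<in> Arr C"
proof -
  obtain i where "(i, p) \<in> E" using assms by (auto simp: adm_epic_def)
  then show ?thesis by (rule ses_homs) (auto simp: Hom_iff)
qed

lemma adm_monic_arr [simp]:
  assumes "adm_monic E i"
  shows "i \<in> Arr C"
proof -
  obtain p where "(i, p) \<in> E" using assms by (auto simp: adm_monic_def)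
  then show ?thesis by (rule ses_homs) (auto simp: Hom_iff)
qed

lemma adm_epic_cancel:
  assumes "adm_epic E p" "p \<in> Hom C A B" "u \<in> Hom C B T" "v \<in> Hom C B T" "u \<cdot> p = v \<cdot> p"
  shows "u = v"
proof -
  obtain i where "(i, p) \<in> E" using assms(1) by (auto simp: adm_epic_def)
  then obtain "is_cokernel C p i" by (rule ses_homs)
  then show ?thesis using cokernel_epic assms by blast
qed

lemma adm_monic_cancel:
  assumes "adm_monic E i" "i \<in> Hom C A B" "u \<in> Hom C T A" "v \<in> Hom C T A" "i \<cdot> u = i \<cdot> v"
  shows "u = v"
proof -
  obtain p where "(i, p) \<in> E" using assms(1) by (auto simp: adm_monic_def)
  then obtain "is_kernel C i p" by (rule ses_homs)
  then show ?thesis using kernel_monic assms by blast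
qed

text \<open>The identity of the source is an admissible epic with some kernel \<open>i\<close>.
  Composing it with an isomorphism gives another cokernel of the same \<open>i\<close>, so
  \<open>ses_cokernel\<close> applies.\<close>

lemma iso_adm_epic:
  assumes "is_iso C f"
  shows "adm_epic E f"
proof -
  obtain g A B where f: "f \<in> Hom C A B" "g \<in> Hom C B A" "g \<cdot> f = Ide C A" "f \<cdot> g = Ide C B"
    using assms by (auto simp: is_iso_def Hom_iff)
  have A: "A \<in> Obj C" "B \<in> Obj C" using f hom_obj by auto
  obtain i where i: "(i, Ide C A) \<in> E" using ide_epic[OF A(1)] by (auto simp: adm_epic_def)
  obtain Z A' A'' where "i \<in> Hom C Z A'" "Ide C A \<in> Hom C A' A''" "Ide C A \<cdot> i = Zer C Z A''"
    using ses_homs[OF i] .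
  \<comment> \<open>A kernel of an identity is a zero arrow, since composing with the identity does
    not change it.\<close>
  then have iz: "i \<in> Hom C Z A" "i = Zer C Z A" "Z \<in> Obj C"
    using A src_obj[of i] by (auto simp: Hom_iff)
  have "is_cokernel C f i"
  proof (rule cokernelI[OF f(1) iz(1)])
    show "f \<cdot> i = Zer C Z B" using f iz A by (simp add: Hom_iff)
    show "\<exists>u \<in> Hom C B T. u \<cdot> f = x" if x: "x \<in> Hom C A T" for T x
      by (rule bexI[of _ "x \<cdot> g"]) (use x f in \<open>auto simp: Hom_iff\<close>)
    show "u = v" if "u \<in> Hom C B T" "v \<in> Hom C B T" "u \<cdot> f = v \<cdot> f" for T u v
      using cmp_assoc[OF f(2,1)] that f(4) ide_right by metis
  qed
  then show ?thesis using ses_cokernel[OF i] by (auto simp: adm_epic_def)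
qed

lemma iso_adm_monic:
  assumes "is_iso C f"
  shows "adm_monic E f"
proof -
  obtain g A B where f: "f \<in> Hom C A B" "g \<in> Hom C B A" "g \<cdot> f = Ide C A" "f \<cdot> g = Ide C B"
    using assms by (auto simp: is_iso_def Hom_iff)
  have A: "A \<in> Obj C" "B \<in> Obj C" using f hom_obj by auto
  obtain p where p: "(Ide C B, p) \<in> E" using ide_monic[OF A(2)] by (auto simp: adm_monic_def)
  obtain B' B'' Z where "Ide C B \<in> Hom C B' B''" "p \<in> Hom C B'' Z" "p \<cdot> Ide C B = Zer C B' Z"
    using ses_homs[OF p] .
  then have pz: "p \<in> Hom C B Z" "p = Zer C B Z" "Z \<in> Obj C"
    using A tgt_obj[of p] by (auto simp: Hom_iff)
  have "is_kernel C f p"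
  proof (rule kernelI[OF f(1) pz(1)])
    show "p \<cdot> f = Zer C A Z" using f pz A by (simp add: Hom_iff)
    show "\<exists>u \<in> Hom C T A. f \<cdot> u = x" if x: "x \<in> Hom C T B" for T x
    proof (rule bexI[of _ "g \<cdot> x"])
      show "f \<cdot> (g \<cdot> x) = x" using cmp_pull[OF f(4,2,1) x] x by (simp add: ide_left)
    qed (use x f in \<open>auto simp: Hom_iff\<close>)
    show "u = v" if "u \<in> Hom C T A" "v \<in> Hom C T A" "f \<cdot> u = f \<cdot> v" for T u v
      using cmp_assoc[OF _ f(1,2)] that f(3) ide_left by metis
  qed
  then show ?thesis using ses_kernel[OF p] by (auto simp: adm_monic_def)
qed

text \<open>Local lifting of an element along an admissible epic: \<open>q\<close> and
  \<open>y\<close> are the two legs of the pull-back of \<open>p\<close> along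
  \<open>x\<close>.\<close>

lemma lift_epic:
  assumes "adm_epic E p" "p \<in> Hom C A B" "x \<in> Hom C T B"
  obtains T' q y where "adm_epic E q" "q \<in> Hom C T' T" "y \<in> Hom C T' A" "p \<cdot> y = x \<cdot> q"
proof -
  have s: "Src C p = A" "Tgt C p = B" "x \<in> Arr C" "Src C x = T" "Tgt C x = B"
    using assms(2,3) by (auto simp: Hom_iff)
  obtain q y where q: "is_pullback C p x q y" "adm_epic E q"
    using epic_pullback[OF assms(1) s(3)] s by auto
  obtain A' B' K P where "p \<in> Hom C A' B'" "x \<in> Hom C K B'" "q \<in> Hom C P K" "y \<in> Hom C P A'"
    "x \<cdot> q = p \<cdot> y"
    using pullbackE[OF q(1)] .
  then show thesis using that[of q P y] s q(2) by (auto simp: Hom_iff)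
qed

text \<open>The axiom yields only some push-out that is an admissible monic. Any other push-out
  arises from it by composing with an isomorphism, and isomorphisms are admissible monics.\<close>

lemma pushout_adm_monic:
  assumes "adm_monic E i" "is_pushout C i f j g"
  shows "adm_monic E j"
proof -
  obtain A B K P where h: "i \<in> Hom C A B" "f \<in> Hom C A K" "j \<in> Hom C K P" "g \<in> Hom C B P"
    "j \<cdot> f = g \<cdot> i"
    and univ: "\<And>T x y. x \<in> Hom C K T \<Longrightarrow> y \<in> Hom C B T \<Longrightarrow> x \<cdot> f = y \<cdot> i \<Longrightarrow>
      \<exists>!u. u \<in> Hom C P T \<and> u \<cdot> j = x \<and> u \<cdot> g = y"
    by (rule pushoutE[OF assms(2)]) blast
  have s: "f \<in> Arr C" "Src C f = A" "Src C i = A" "Tgt C f = K" "Tgt C i = B"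
    using h(1,2) by (auto simp: Hom_iff)
  obtain j' g' where po: "is_pushout C i f j' g'" and j': "adm_monic E j'"
    using monic_pushout[OF assms(1) s(1)] s by auto
  obtain A' B' K' P' where "i \<in> Hom C A' B'" "f \<in> Hom C A' K'" "j' \<in> Hom C K' P'"
    "g' \<in> Hom C B' P'" "j' \<cdot> f = g' \<cdot> i"
    and univ': "\<And>T x y. x \<in> Hom C K' T \<Longrightarrow> y \<in> Hom C B' T \<Longrightarrow> x \<cdot> f = y \<cdot> i \<Longrightarrow>
      \<exists>!u. u \<in> Hom C P' T \<and> u \<cdot> j' = x \<and> u \<cdot> g' = y"
    by (rule pushoutE[OF po]) blast
  \<comment> \<open>\<open>pushoutE\<close> names the objects afresh; the targets of
    \<open>f\<close> and \<open>i\<close> identify them with those already present.\<close>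
  moreover from this have "K' = K" "B' = B" using s by (simp_all add: Hom_iff)
  ultimately have h': "j' \<in> Hom C K P'" "g' \<in> Hom C B P'" "j' \<cdot> f = g' \<cdot> i"
    and univ': "\<And>T x y. x \<in> Hom C K T \<Longrightarrow> y \<in> Hom C B T \<Longrightarrow> x \<cdot> f = y \<cdot> i \<Longrightarrow>
      \<exists>!u. u \<in> Hom C P' T \<and> u \<cdot> j' = x \<and> u \<cdot> g' = y"
    by simp_all
  obtain u where u: "u \<in> Hom C P P'" "u \<cdot> j = j'" "u \<cdot> g = g'" using univ[OF h'] by blast
  obtain v where v: "v \<in> Hom C P' P" "v \<cdot> j' = j" "v \<cdot> g' = g" using univ'[OF h(3-5)] by blast
  have o: "P \<in> Obj C" "P' \<in> Obj C" using u hom_obj by auto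
  have "v \<cdot> u \<in> Hom C P P" "(v \<cdot> u) \<cdot> j = j" "(v \<cdot> u) \<cdot> g = g"
    using u v h by (simp_all add: Hom_iff)
  moreover have "Ide C P \<in> Hom C P P" "Ide C P \<cdot> j = j" "Ide C P \<cdot> g = g"
    using h o by (simp_all add: Hom_iff)
  ultimately have 1: "v \<cdot> u = Ide C P" using univ[OF h(3-5)] by blast
  have "u \<cdot> v \<in> Hom C P' P'" "(u \<cdot> v) \<cdot> j' = j'" "(u \<cdot> v) \<cdot> g' = g'"
    using u v h' by (simp_all add: Hom_iff)
  moreover have "Ide C P' \<in> Hom C P' P'" "Ide C P' \<cdot> j' = j'" "Ide C P' \<cdot> g' = g'"
    using h' o by (simp_all add: Hom_iff)
  ultimately have "u \<cdot> v = Ide C P'" using univ'[OF h'] by blast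
  then have "is_iso C v" using is_isoI[OF v(1) u(1)] 1 by blast
  then have "adm_monic E (v \<cdot> j')"
    by (rule monic_cmp[OF j' iso_adm_monic]) (use v(1) h'(1) in \<open>simp_all add: Hom_iff\<close>)
  then show ?thesis using v by simp
qed

text \<open>Dual to \<open>pushout_adm_monic\<close>: the comparison isomorphism now precedes the
  pull-back given by the axiom.\<close>

lemma pullback_adm_epic:
  assumes "adm_epic E p" "is_pullback C p f q g"
  shows "adm_epic E q"
proof -
  obtain A B K P where h: "p \<in> Hom C A B" "f \<in> Hom C K B" "q \<in> Hom C P K" "g \<in> Hom C P A"
    "f \<cdot> q = p \<cdot> g"
    and univ: "\<And>T x y. x \<in> Hom C T K \<Longrightarrow> y \<in> Hom C T A \<Longrightarrow> f \<cdot> x = p \<cdot> y \<Longrightarrow>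
      \<exists>!u. u \<in> Hom C T P \<and> q \<cdot> u = x \<and> g \<cdot> u = y"
    by (rule pullbackE[OF assms(2)]) blast
  have s: "f \<in> Arr C" "Src C f = K" "Src C p = A" "Tgt C f = B" "Tgt C p = B"
    using h(1,2) by (auto simp: Hom_iff)
  obtain q' g' where po: "is_pullback C p f q' g'" and q': "adm_epic E q'"
    using epic_pullback[OF assms(1) s(1)] s by auto
  obtain A' B' K' P' where "p \<in> Hom C A' B'" "f \<in> Hom C K' B'" "q' \<in> Hom C P' K'"
    "g' \<in> Hom C P' A'" "f \<cdot> q' = p \<cdot> g'"
    and univ': "\<And>T x y. x \<in> Hom C T K' \<Longrightarrow> y \<in> Hom C T A' \<Longrightarrow> f \<cdot> x = p \<cdot> y \<Longrightarrow>
      \<exists>!u. u \<in> Hom C T P' \<and> q' \<cdot> u = x \<and> g' \<cdot> u = y"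
    by (rule pullbackE[OF po]) blast
  moreover from this have "K' = K" "A' = A" using s by (simp_all add: Hom_iff)
  ultimately have h': "q' \<in> Hom C P' K" "g' \<in> Hom C P' A" "f \<cdot> q' = p \<cdot> g'"
    and univ': "\<And>T x y. x \<in> Hom C T K \<Longrightarrow> y \<in> Hom C T A \<Longrightarrow> f \<cdot> x = p \<cdot> y \<Longrightarrow>
      \<exists>!u. u \<in> Hom C T P' \<and> q' \<cdot> u = x \<and> g' \<cdot> u = y"
    by simp_all
  obtain u where u: "u \<in> Hom C P' P" "q \<cdot> u = q'" "g \<cdot> u = g'" using univ[OF h'] by blast
  obtain v where v: "v \<in> Hom C P P'" "q' \<cdot> v = q" "g' \<cdot> v = g" using univ'[OF h(3-5)] by blast
  have o: "P \<in> Obj C" "P' \<in> Obj C" using u hom_obj by auto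
  have "u \<cdot> v \<in> Hom C P P" "q \<cdot> (u \<cdot> v) = q" "g \<cdot> (u \<cdot> v) = g"
    using cmp_hom[OF v(1) u(1)] cmp_pull[OF u(2,1) h(3) v(1)] cmp_pull[OF u(3,1) h(4) v(1)] v
    by simp_all
  moreover have "Ide C P \<in> Hom C P P" "q \<cdot> Ide C P = q" "g \<cdot> Ide C P = g"
    using h o by (simp_all add: Hom_iff)
  ultimately have 1: "u \<cdot> v = Ide C P" using univ[OF h(3-5)] by blast
  have "v \<cdot> u \<in> Hom C P' P'" "q' \<cdot> (v \<cdot> u) = q'" "g' \<cdot> (v \<cdot> u) = g'"
    using cmp_hom[OF u(1) v(1)] cmp_pull[OF v(2,1) h'(1) u(1)] cmp_pull[OF v(3,1) h'(2) u(1)] u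
    by simp_all
  moreover have "Ide C P' \<in> Hom C P' P'" "q' \<cdot> Ide C P' = q'" "g' \<cdot> Ide C P' = g'"
    using h' o by (simp_all add: Hom_iff)
  ultimately have "v \<cdot> u = Ide C P'" using univ'[OF h'] by blast
  then have "is_iso C v" using is_isoI[OF v(1) u(1)] 1 by blast
  then have "adm_epic E (q' \<cdot> v)"
    by (rule epic_cmp[OF iso_adm_epic q']) (use v(1) h'(1) in \<open>simp_all add: Hom_iff\<close>)
  then show ?thesis using v by simp
qed

section \<open>Towards cancelling the first factor of an admissible epic\<close>

lemma adm_epicE:
  assumes "adm_epic E p" "p \<in> Hom C A B"
  obtains A' i where "(i, p) \<in> E" "i \<in> Hom C A' A" "p \<cdot> i = Zer C A' B"
    "is_kernel C i p" "is_cokernel C p i"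
proof -
  obtain i where i: "(i, p) \<in> E" using assms(1) by (auto simp: adm_epic_def)
  obtain A' A1 A2 where h: "i \<in> Hom C A' A1" "p \<in> Hom C A1 A2" "p \<cdot> i = Zer C A' A2"
    and k: "is_kernel C i p" "is_cokernel C p i" using ses_homs[OF i] .
  have "A1 = A" "A2 = B" using h(2) assms(2) by (simp_all add: Hom_iff)
  then show thesis using that i h k by blast
qed

lemma adm_monicE:
  assumes "adm_monic E i" "i \<in> Hom C A B"
  obtains B' p where "(i, p) \<in> E" "p \<in> Hom C B B'" "p \<cdot> i = Zer C A B'"
    "is_kernel C i p" "is_cokernel C p i"
proof -
  obtain p where p: "(i, p) \<in> E" using assms(1) by (auto simp: adm_monic_def)
  obtain A1 A2 B' where h: "i \<in> Hom C A1 A2" "p \<in> Hom C A2 B'" "p \<cdot> i = Zer C A1 B'"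
    and k: "is_kernel C i p" "is_cokernel C p i" using ses_homs[OF p] .
  have "A1 = A" "A2 = B" using h(1) assms(2) by (simp_all add: Hom_iff)
  then show thesis using that p h k by blast
qed

text \<open>With \<open>t\<close> the projection to the kernel \<open>K\<close>, the pair \<open>(r, t)\<close> exhibits \<open>P\<close> as the product
  of \<open>A\<close> and \<open>K\<close>, so \<open>r\<close> is a pull-back of \<open>K \<rightarrow> 0\<close>.\<close>

lemma split_epi_adm_epic:
  assumes r: "r \<in> Hom C P A" and s: "s \<in> Hom C A P" and rs: "r \<cdot> s = Ide C A"
    and kr: "is_kernel C k r"
  shows "adm_epic E r"
proof -
  define K where "K = Src C k"
  have k: "k \<in> Hom C K P" and rk: "r \<cdot> k = Zer C K A"
    using kernelD[OF kr] r by (simp_all add: Hom_iff K_def)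
  have o: "P \<in> Obj C" "A \<in> Obj C" "K \<in> Obj C" using r k hom_obj by auto
  have idK: "Ide C K \<in> Hom C K K" and idP: "Ide C P \<in> Hom C P P" using ide_hom o by auto
  \<comment> \<open>A cokernel of the identity of \<open>K\<close> is a zero arrow into a zero
    object. This is the admissible epic that will be pulled back.\<close>
  obtain Z p where p: "(Ide C K, p) \<in> E" "p \<in> Hom C K Z" "p \<cdot> Ide C K = Zer C K Z"
    and pc: "is_cokernel C p (Ide C K)"
    using adm_monicE[OF ide_monic[OF o(3)] idK] .
  have Z: "Z \<in> Obj C" using p hom_obj by auto
  have p0: "p = Zer C K Z" using p by (simp add: Hom_iff)
  have "Ide C Z \<cdot> p = Zer C Z Z \<cdot> p" using p0 o Z by simp
  then have "Ide C Z = Zer C Z Z" by (rule cokernel_epic[OF pc p(2) ide_hom[OF Z] zer_hom[OF Z Z]])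
  have sr: "s \<cdot> r \<in> Hom C P P" using cmp_hom[OF r s] .
  have d: "diff (Ide C P) (s \<cdot> r) \<in> Hom C P P" using diff_hom[OF idP sr] .
  \<comment> \<open>The idempotent \<open>1 - s \<cdot> r\<close> is killed by \<open>r\<close>, so
    it factors through the kernel; the factor \<open>t\<close> is the projection to
    \<open>K\<close>.\<close>
  have "r \<cdot> diff (Ide C P) (s \<cdot> r) = diff (r \<cdot> Ide C P) (r \<cdot> (s \<cdot> r))"
    using cmp_diff_right[OF idP sr r] .
  also have "\<dots> = diff r r" using cmp_pull[OF rs s r r] r ide_left[OF r] ide_right[OF r] by simp
  also have "\<dots> = Zer C P A" using diff_self[OF r r] .
  finally obtain t where t: "t \<in> Hom C P K" "k \<cdot> t = diff (Ide C P) (s \<cdot> r)"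
    using kernel_lift[OF kr k r d] by blast
  have "k \<cdot> (t \<cdot> k) = diff (Ide C P) (s \<cdot> r) \<cdot> k" using cmp_pull[OF t(2,1) k k] .
  also have "\<dots> = diff (Ide C P \<cdot> k) ((s \<cdot> r) \<cdot> k)" using cmp_diff_left[OF idP sr k] .
  also have "(s \<cdot> r) \<cdot> k = Zer C K P"
    using cmp_assoc[OF k r s] rk cmp_zer(1)[OF s o(3)] by simp
  also have "diff (Ide C P \<cdot> k) (Zer C K P) = k \<cdot> Ide C K"
    using ide_left[OF k] ide_right[OF k] diff_zer_right[OF k k] by simp
  finally have tk: "t \<cdot> k = Ide C K" by (rule kernel_monic[OF kr k cmp_hom[OF k t(1)] idK])
  have "k \<cdot> (t \<cdot> s) = diff (Ide C P) (s \<cdot> r) \<cdot> s" using cmp_pull[OF t(2,1) k s] .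
  also have "\<dots> = diff (Ide C P \<cdot> s) ((s \<cdot> r) \<cdot> s)" using cmp_diff_left[OF idP sr s] .
  also have "\<dots> = diff s s" using cmp_assoc[OF s r s] rs ide_right[OF s] ide_left[OF s] by simp
  also have "\<dots> = k \<cdot> Zer C A K" using diff_self[OF s s] cmp_zer(1)[OF k o(2)] by simp
  finally have ts: "t \<cdot> s = Zer C A K"
    by (rule kernel_monic[OF kr k cmp_hom[OF s t(1)] zer_hom[OF o(2,3)]])
  \<comment> \<open>The decomposition \<open>1 = k \<cdot> t + s \<cdot> r\<close> recovers an
    element from its two projections; this gives uniqueness in the pull-back.\<close>
  have split: "Add C (k \<cdot> (t \<cdot> u)) (s \<cdot> (r \<cdot> u)) = u" if u: "u \<in> Hom C T P" for T u
  proof -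
    have "Add C (k \<cdot> (t \<cdot> u)) (s \<cdot> (r \<cdot> u)) = Add C (diff (Ide C P) (s \<cdot> r)) (s \<cdot> r) \<cdot> u"
      using cmp_add_left[OF u d sr] cmp_pull[OF t(2,1) k u] cmp_assoc[OF u r s] by simp
    then show ?thesis using diff_add[OF idP sr] ide_left[OF u] by simp
  qed
  have "is_pullback C p (Zer C A Z) r t"
  proof (rule pullbackI[OF p(2) zer_hom[OF o(2) Z] r t(1)])
    show "Zer C A Z \<cdot> r = p \<cdot> t" using p0 cmp_zer(2)[OF r Z] cmp_zer(2)[OF t(1) Z] by simp
  next
    fix T x y assume x: "x \<in> Hom C T A" and y: "y \<in> Hom C T K"
    have T: "T \<in> Obj C" using x hom_obj by auto
    \<comment> \<open>The element with projections \<open>x\<close> and \<open>y\<close> is the sum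
      \<open>s \<cdot> x + k \<cdot> y\<close>.\<close>
    have sx: "s \<cdot> x \<in> Hom C T P" and ky: "k \<cdot> y \<in> Hom C T P"
      using cmp_hom[OF x s] cmp_hom[OF y k] .
    have "r \<cdot> Add C (s \<cdot> x) (k \<cdot> y) = Add C (r \<cdot> (s \<cdot> x)) (r \<cdot> (k \<cdot> y))"
      using cmp_add_right[OF sx ky r] .
    also have "\<dots> = x"
      using cmp_pull[OF rs s r x] cmp_pull_zer[OF rk k r y] ide_left[OF x] add_zer_right[OF x x]
      by simp
    finally have 1: "r \<cdot> Add C (s \<cdot> x) (k \<cdot> y) = x" .
    have "t \<cdot> Add C (s \<cdot> x) (k \<cdot> y) = Add C (t \<cdot> (s \<cdot> x)) (t \<cdot> (k \<cdot> y))"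
      using cmp_add_right[OF sx ky t(1)] .
    also have "\<dots> = y"
      using cmp_pull[OF tk k t(1) y] cmp_pull_zer[OF ts s t(1) x] ide_left[OF y]
        add_zer_left[OF y y]
      by simp
    finally show "\<exists>u \<in> Hom C T P. r \<cdot> u = x \<and> t \<cdot> u = y"
      using 1 by (intro bexI[OF _ add_hom[OF sx ky]]) simp
  next
    fix T u v assume u: "u \<in> Hom C T P" and v: "v \<in> Hom C T P"
      and eq: "r \<cdot> u = r \<cdot> v" "t \<cdot> u = t \<cdot> v"
    show "u = v" using split[OF u] split[OF v] unfolding eq by (rule trans[OF sym])
  qed
  moreover have "adm_epic E p" using p by (auto simp: adm_epic_def)
  ultimately show ?thesis using pullback_adm_epic by blast
qed

text \<open>The square formed by \<open>ker (g \<cdot> q)\<close>, \<open>q\<close> and \<open>j\<close> is bicartesian, so \<open>j\<close> is a push-out of an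
  admissible monic.\<close>

lemma adm_epic_of_epic_cmp:
  assumes q: "q \<in> Hom C P B" and g: "g \<in> Hom C B D"
    and qe: "adm_epic E q" and gqe: "adm_epic E (g \<cdot> q)" and jk: "is_kernel C j g"
  shows "adm_epic E g"
proof -
  define K where "K = Src C j"
  have j: "j \<in> Hom C K B" and gj: "g \<cdot> j = Zer C K D"
    using kernelD[OF jk] g by (simp_all add: Hom_iff K_def)
  have gq: "g \<cdot> q \<in> Hom C P D" using cmp_hom[OF q g] .
  obtain L l where lE: "(l, g \<cdot> q) \<in> E" and l: "l \<in> Hom C L P" and gql: "(g \<cdot> q) \<cdot> l = Zer C L D"
    and lk: "is_kernel C l (g \<cdot> q)" and gqc: "is_cokernel C (g \<cdot> q) l"
    using adm_epicE[OF gqe gq] .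
  have ql: "q \<cdot> l \<in> Hom C L B" using cmp_hom[OF l q] .
  have "g \<cdot> (q \<cdot> l) = Zer C L D" using gql cmp_assoc[OF l q g] by simp
  then obtain q' where q': "q' \<in> Hom C L K" "j \<cdot> q' = q \<cdot> l"
    using kernel_lift[OF jk j g ql] by blast
  \<comment> \<open>The cartesian half of the claim, which makes \<open>q'\<close> an admissible
    epic and hence right cancellable in the push-out half.\<close>
  have "is_pullback C q j q' l"
  proof (rule pullbackI[OF q j q'(1) l q'(2)])
    fix T x y assume x: "x \<in> Hom C T K" and y: "y \<in> Hom C T P" and xy: "j \<cdot> x = q \<cdot> y"
    have "(g \<cdot> q) \<cdot> y = g \<cdot> (j \<cdot> x)" using cmp_assoc[OF y q g] xy by simp
    also have "\<dots> = Zer C T D" using cmp_pull_zer[OF gj j g x] .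
    finally obtain u where u: "u \<in> Hom C T L" "l \<cdot> u = y"
      using kernel_lift[OF lk l gq y] by blast
    have "j \<cdot> (q' \<cdot> u) = q \<cdot> (l \<cdot> u)" using cmp_square[OF q'(2) q'(1) j l q u(1)] .
    then have "j \<cdot> (q' \<cdot> u) = j \<cdot> x" using u xy by simp
    then have "q' \<cdot> u = x" using kernel_monic[OF jk j cmp_hom[OF u(1) q'(1)] x] by blast
    then show "\<exists>u \<in> Hom C T L. q' \<cdot> u = x \<and> l \<cdot> u = y" using u by (intro bexI[OF _ u(1)]) simp_all
  qed (use kernel_monic[OF lk l] in blast)
  then have q'e: "adm_epic E q'" using pullback_adm_epic[OF qe] by blast
  \<comment> \<open>The kernel \<open>n\<close> of \<open>q\<close> factors through
    \<open>l\<close>, and its factor \<open>m\<close> is killed by \<open>q'\<close>. Hence every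
    \<open>y\<close> compatible with some \<open>x\<close> vanishes on \<open>n\<close> and descends
    along \<open>q\<close>, which is the existence part of the push-out property.\<close>
  obtain N n where n: "n \<in> Hom C N P" "q \<cdot> n = Zer C N B" and qc: "is_cokernel C q n"
    using adm_epicE[OF qe q] .
  have o: "N \<in> Obj C" "B \<in> Obj C" "K \<in> Obj C" using n j hom_obj by auto
  have "(g \<cdot> q) \<cdot> n = Zer C N D" using cmp_assoc[OF n(1) q g] n(2) cmp_zer(1)[OF g o(1)] by simp
  then obtain m where m: "m \<in> Hom C N L" "l \<cdot> m = n"
    using kernel_lift[OF lk l gq n(1)] by blast
  have "j \<cdot> (q' \<cdot> m) = j \<cdot> Zer C N K"
    using cmp_square[OF q'(2) q'(1) j l q m(1)] m n cmp_zer(1)[OF j o(1)] by simp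
  then have q'm: "q' \<cdot> m = Zer C N K"
    by (rule kernel_monic[OF jk j cmp_hom[OF m(1) q'(1)] zer_hom[OF o(1,3)]])
  have "is_pushout C l q' j q"
  proof (rule pushoutI[OF l q'(1) j q q'(2)])
    fix T x y assume x: "x \<in> Hom C K T" and y: "y \<in> Hom C P T" and xy: "x \<cdot> q' = y \<cdot> l"
    have "y \<cdot> n = x \<cdot> (q' \<cdot> m)" using cmp_square[OF xy q'(1) x l y m(1)] m by simp
    also have "\<dots> = Zer C N T" using q'm cmp_zer(1)[OF x o(1)] by simp
    finally obtain u where u: "u \<in> Hom C B T" "u \<cdot> q = y"
      using cokernel_lift[OF qc q n(1) y] by blast
    have "(u \<cdot> j) \<cdot> q' = u \<cdot> (q \<cdot> l)" using cmp_assoc[OF q'(1) j u(1)] q' by simp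
    also have "\<dots> = x \<cdot> q'" using cmp_pull[OF u(2) q u(1) l] xy by simp
    finally have "u \<cdot> j = x" by (rule adm_epic_cancel[OF q'e q'(1) cmp_hom[OF j u(1)] x])
    then show "\<exists>u \<in> Hom C B T. u \<cdot> j = x \<and> u \<cdot> q = y" using u by (intro bexI[OF _ u(1)]) simp_all
  qed (use cokernel_epic[OF qc q] in blast)
  moreover have "adm_monic E l" using lE by (auto simp: adm_monic_def)
  ultimately have jm: "adm_monic E j" using pushout_adm_monic by blast
  \<comment> \<open>Once \<open>j\<close> is an admissible monic, \<open>g\<close> only has to be a
    cokernel of it. Factorizations are found for \<open>g \<cdot> q\<close>, and \<open>q\<close> is
    then cancelled.\<close>
  have "is_cokernel C g j"
  proof (rule cokernelI[OF g j gj])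
    fix T x assume x: "x \<in> Hom C B T" and xj: "x \<cdot> j = Zer C K T"
    have xq: "x \<cdot> q \<in> Hom C P T" using cmp_hom[OF q x] .
    have "(x \<cdot> q) \<cdot> l = x \<cdot> (j \<cdot> q')" using cmp_assoc[OF l q x] q' by simp
    also have "\<dots> = Zer C L T" using cmp_pull_zer[OF xj j x q'(1)] .
    finally obtain u where u: "u \<in> Hom C D T" "u \<cdot> (g \<cdot> q) = x \<cdot> q"
      using cokernel_lift[OF gqc gq l xq] by blast
    have "(u \<cdot> g) \<cdot> q = x \<cdot> q" using cmp_assoc[OF q g u(1)] u by simp
    then have "u \<cdot> g = x" by (rule adm_epic_cancel[OF qe q cmp_hom[OF g u(1)] x])
    then show "\<exists>u \<in> Hom C D T. u \<cdot> g = x" using u by (intro bexI[OF _ u(1)]) simp_all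
  next
    fix T u v assume u: "u \<in> Hom C D T" and v: "v \<in> Hom C D T" and uv: "u \<cdot> g = v \<cdot> g"
    have "u \<cdot> (g \<cdot> q) = v \<cdot> (g \<cdot> q)" using cmp_square[OF uv g u g v q] .
    then show "u = v" by (rule cokernel_epic[OF gqc gq u v])
  qed
  then show ?thesis using adm_monic_cokernel[OF jm] by (auto simp: adm_epic_def)
qed

end

section \<open>Cancellation under weak idempotent completeness\<close>

locale weakly_idempotent_complete_exact_category = exact_category C E
  for C :: "('o, 'm, 'z) precat_scheme" (structure) and E :: "('m \<times> 'm) set" +
  assumes retraction_kernel: "weakly_idempotent_complete C"
begin

text \<open>The pull-back of \<open>g \<cdot> f\<close> along \<open>g\<close> has a section over \<open>A\<close> given by \<open>(f, 1)\<close>; the kernel of this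
  retraction provides a kernel of \<open>g\<close>.\<close>

lemma adm_epic_of_cmp:
  assumes f: "f \<in> Hom C A B" and g: "g \<in> Hom C B D" and gfe: "adm_epic E (g \<cdot> f)"
  shows "adm_epic E g"
proof -
  have gf: "g \<cdot> f \<in> Hom C A D" using cmp_hom[OF f g] .
  have t: "g \<in> Arr C" "Tgt C g = Tgt C (g \<cdot> f)" "Src C (g \<cdot> f) = A" "Src C g = B"
    using g gf by (simp_all add: Hom_iff)
  obtain q r where qr: "is_pullback C (g \<cdot> f) g q r" and qe: "adm_epic E q"
    using epic_pullback[OF gfe t(1,2)] by blast
  obtain A' D' B' P where "g \<cdot> f \<in> Hom C A' D'" "g \<in> Hom C B' D'" "q \<in> Hom C P B'"
    "r \<in> Hom C P A'" "g \<cdot> q = (g \<cdot> f) \<cdot> r"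
    and univ': "\<And>T x y. x \<in> Hom C T B' \<Longrightarrow> y \<in> Hom C T A' \<Longrightarrow> g \<cdot> x = (g \<cdot> f) \<cdot> y \<Longrightarrow>
      \<exists>!u. u \<in> Hom C T P \<and> q \<cdot> u = x \<and> r \<cdot> u = y"
    by (rule pullbackE[OF qr]) blast
  moreover from this have "A' = A" "B' = B" using t by (simp_all add: Hom_iff)
  ultimately have q: "q \<in> Hom C P B" and r: "r \<in> Hom C P A" and sq: "g \<cdot> q = (g \<cdot> f) \<cdot> r"
    and univ: "\<And>T x y. x \<in> Hom C T B \<Longrightarrow> y \<in> Hom C T A \<Longrightarrow> g \<cdot> x = (g \<cdot> f) \<cdot> y \<Longrightarrow>
      \<exists>!u. u \<in> Hom C T P \<and> q \<cdot> u = x \<and> r \<cdot> u = y"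
    by simp_all
  have o: "A \<in> Obj C" "D \<in> Obj C" using gf hom_obj by auto
  have "g \<cdot> f = (g \<cdot> f) \<cdot> Ide C A" using ide_right[OF gf] by simp
  then obtain s where s: "s \<in> Hom C A P" "r \<cdot> s = Ide C A"
    using univ[OF f ide_hom[OF o(1)]] by blast
  have "is_retraction C r" using r s by (auto simp: is_retraction_def Hom_iff)
  then obtain k where kr: "is_kernel C k r"
    using retraction_kernel by (auto simp: weakly_idempotent_complete_def)
  define K where "K = Src C k"
  have k: "k \<in> Hom C K P" and rk: "r \<cdot> k = Zer C K A"
    using kernelD[OF kr] r by (simp_all add: Hom_iff K_def)
  have "adm_epic E r" using split_epi_adm_epic[OF r s kr] .
  \<comment> \<open>By the pull-back square \<open>g \<cdot> q\<close> is a composite of two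
    admissible epics, although nothing is known yet about \<open>g\<close> itself.\<close>
  then have "adm_epic E ((g \<cdot> f) \<cdot> r)"
    by (rule epic_cmp[OF _ gfe]) (use gf r in \<open>simp add: Hom_iff\<close>)
  then have gqe: "adm_epic E (g \<cdot> q)" using sq by simp
  have qk: "q \<cdot> k \<in> Hom C K B" using cmp_hom[OF k q] .
  have K: "K \<in> Obj C" using k hom_obj by auto
  \<comment> \<open>An element \<open>x\<close> killed by \<open>g\<close> is the same as an element
    \<open>(x, 0)\<close> of the pull-back, and these are the elements of the kernel of
    \<open>r\<close>. So the kernel of \<open>r\<close>, pushed forward by \<open>q\<close>, is a
    kernel of \<open>g\<close>.\<close>
  have "is_kernel C (q \<cdot> k) g"
  proof (rule kernelI[OF qk g])
    show "g \<cdot> (q \<cdot> k) = Zer C K D"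
      using cmp_square[OF sq q g r gf k] rk cmp_zer(1)[OF gf K] by simp
  next
    fix T x assume x: "x \<in> Hom C T B" and gx: "g \<cdot> x = Zer C T D"
    have T: "T \<in> Obj C" using x hom_obj by auto
    have "g \<cdot> x = (g \<cdot> f) \<cdot> Zer C T A" using gx cmp_zer(1)[OF gf T] by simp
    then obtain u where u: "u \<in> Hom C T P" "q \<cdot> u = x" "r \<cdot> u = Zer C T A"
      using univ[OF x zer_hom[OF T o(1)]] by blast
    obtain w where w: "w \<in> Hom C T K" "k \<cdot> w = u" using kernel_lift[OF kr k r u(1,3)] .
    have "(q \<cdot> k) \<cdot> w = x" using cmp_assoc[OF w(1) k q] w u by simp
    then show "\<exists>w \<in> Hom C T K. (q \<cdot> k) \<cdot> w = x" using w by (intro bexI[OF _ w(1)]) simp_all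
  next
    fix T u v assume u: "u \<in> Hom C T K" and v: "v \<in> Hom C T K" and uv: "(q \<cdot> k) \<cdot> u = (q \<cdot> k) \<cdot> v"
    have T: "T \<in> Obj C" using u hom_obj by auto
    have ku: "k \<cdot> u \<in> Hom C T P" and kv: "k \<cdot> v \<in> Hom C T P"
      using cmp_hom[OF u k] cmp_hom[OF v k] .
    have ruv: "r \<cdot> (k \<cdot> u) = Zer C T A" "r \<cdot> (k \<cdot> v) = Zer C T A"
      using cmp_pull_zer[OF rk k r u] cmp_pull_zer[OF rk k r v] .
    have quv: "q \<cdot> (k \<cdot> u) = q \<cdot> (k \<cdot> v)"
      using uv cmp_assoc[OF u k q] cmp_assoc[OF v k q] by simp
    have "g \<cdot> (q \<cdot> (k \<cdot> u)) = (g \<cdot> f) \<cdot> Zer C T A"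
      using cmp_square[OF sq q g r gf ku] ruv by simp
    then have "k \<cdot> u = k \<cdot> v"
      using univ[OF cmp_hom[OF ku q] zer_hom[OF T o(1)]] ku kv ruv quv by metis
    then show "u = v" by (rule kernel_monic[OF kr k u v])
  qed
  then show ?thesis by (rule adm_epic_of_epic_cmp[OF q g qe gqe])
qed

section \<open>Admissible morphisms and exact pairs\<close>

lemma adm_epic_admissible:
  assumes "adm_epic E p"
  shows "adm_factorization C E p p (Ide C (Tgt C p))" "admissible C E p"
proof -
  show "adm_factorization C E p p (Ide C (Tgt C p))"
    using assms ide_monic[of "Tgt C p"] tgt_obj[of p] by (simp add: adm_factorization_def)
  then show "admissible C E p" by (auto simp: admissible_def)
qed

lemma adm_monic_admissible:
  assumes "adm_monic E i"
  shows "adm_factorization C E i (Ide C (Src C i)) i" "admissible C E i"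
proof -
  show "adm_factorization C E i (Ide C (Src C i)) i"
    using assms ide_epic[of "Src C i"] src_obj[of i] by (simp add: adm_factorization_def)
  then show "admissible C E i" by (auto simp: admissible_def)
qed

lemma adm_factorizationE:
  assumes "adm_factorization C E f e m" "f \<in> Hom C A B"
  obtains I where "e \<in> Hom C A I" "m \<in> Hom C I B" "adm_epic E e" "adm_monic E m" "m \<cdot> e = f"
proof -
  have a: "adm_epic E e" "adm_monic E m" "Tgt C e = Src C m" "m \<cdot> e = f"
    using assms(1) by (simp_all add: adm_factorization_def)
  have s: "Src C (m \<cdot> e) = Src C e" "Tgt C (m \<cdot> e) = Tgt C m" using a(1-3) by simp_all
  have "e \<in> Hom C A (Src C m)" "m \<in> Hom C (Src C m) B"
    using a s assms(2) by (simp_all add: Hom_iff)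
  then show thesis using that a by blast
qed

lemma exact_pair_admissible:
  assumes "exact_pair C E f g"
  shows "admissible C E f" "admissible C E g"
  using assms by (auto simp: exact_pair_def admissible_def)

text \<open>The monic part of \<open>g\<close> can be cancelled, so \<open>x\<close> is killed by
  the epic part \<open>e'\<close> and factors through the image \<open>m\<close> of
  \<open>f\<close>. The factor is then lifted locally along the epic part of
  \<open>f\<close>.\<close>

lemma exact_pair_lift:
  assumes fg: "exact_pair C E f g" and f: "f \<in> Hom C A B" and g: "g \<in> Hom C B D"
    and x: "x \<in> Hom C T B" and gx: "g \<cdot> x = Zer C T D"
  obtains T' q y where "adm_epic E q" "q \<in> Hom C T' T" "y \<in> Hom C T' A" "f \<cdot> y = x \<cdot> q"
proof -
  obtain e m e' m' where em: "adm_factorization C E f e m" and em': "adm_factorization C E g e' m'"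
    and s: "(m, e') \<in> E"
    using fg by (auto simp: exact_pair_def)
  obtain I where e: "e \<in> Hom C A I" "adm_epic E e" and m: "m \<in> Hom C I B" and me: "m \<cdot> e = f"
    using adm_factorizationE[OF em f] .
  obtain J where e': "e' \<in> Hom C B J" and m': "m' \<in> Hom C J D" "adm_monic E m'"
    and me': "m' \<cdot> e' = g"
    using adm_factorizationE[OF em' g] .
  have mk: "is_kernel C m e'"
    using kernel_cokernel[OF s] by (simp add: kernel_cokernel_pair_def)
  have T: "T \<in> Obj C" "J \<in> Obj C" using x e' hom_obj by auto
  have "m' \<cdot> (e' \<cdot> x) = m' \<cdot> Zer C T J"
    using cmp_pull[OF me' e' m'(1) x] gx cmp_zer(1)[OF m'(1) T(1)] by simp
  then have "e' \<cdot> x = Zer C T J"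
    by (rule adm_monic_cancel[OF m'(2,1) cmp_hom[OF x e'] zer_hom[OF T]])
  then obtain u where u: "u \<in> Hom C T I" "m \<cdot> u = x" using kernel_lift[OF mk m e' x] by blast
  obtain T' q y where q: "adm_epic E q" "q \<in> Hom C T' T" "y \<in> Hom C T' A" "e \<cdot> y = u \<cdot> q"
    using lift_epic[OF e(2,1) u(1)] .
  have "f \<cdot> y = m \<cdot> (e \<cdot> y)" using cmp_pull[OF me e(1) m q(3)] by simp
  also have "\<dots> = x \<cdot> q" using cmp_pull[OF u(2,1) m q(2)] q(4) by simp
  finally show thesis using that q by blast
qed

text \<open>Converse of \<open>exact_pair_lift\<close>, which yields the admissibility of
  \<open>f\<close> as well. Let \<open>m\<close> be the kernel of the epic part of \<open>g\<close>;
  then \<open>f = m \<cdot> e\<close>. Lifting \<open>m\<close> itself, the universal element killed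
  by \<open>g\<close>, gives \<open>y\<close> with \<open>e \<cdot> y\<close> an admissible epic,
  and \<open>adm_epic_of_cmp\<close> passes this on to \<open>e\<close>.\<close>

lemma exact_pairI:
  assumes f: "f \<in> Hom C A B" and g: "g \<in> Hom C B D" and ga: "admissible C E g"
    and gf: "g \<cdot> f = Zer C A D"
    and lift: "\<And>T x. x \<in> Hom C T B \<Longrightarrow> g \<cdot> x = Zer C T D \<Longrightarrow>
      \<exists>T' q y. adm_epic E q \<and> q \<in> Hom C T' T \<and> y \<in> Hom C T' A \<and> f \<cdot> y = x \<cdot> q"
  shows "exact_pair C E f g"
proof -
  obtain e' m' where em': "adm_factorization C E g e' m'" using ga by (auto simp: admissible_def)
  obtain J where e': "e' \<in> Hom C B J" "adm_epic E e'" and m': "m' \<in> Hom C J D" "adm_monic E m'"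
    and me': "m' \<cdot> e' = g"
    using adm_factorizationE[OF em' g] .
  obtain I m where mE: "(m, e') \<in> E" and m: "m \<in> Hom C I B" "e' \<cdot> m = Zer C I J"
    and mk: "is_kernel C m e'"
    using adm_epicE[OF e'(2,1)] .
  have o: "A \<in> Obj C" "J \<in> Obj C" "I \<in> Obj C" using f e' m hom_obj by auto
  have "m' \<cdot> (e' \<cdot> f) = m' \<cdot> Zer C A J"
    using cmp_pull[OF me' e'(1) m'(1) f] gf cmp_zer(1)[OF m'(1) o(1)] by simp
  then have "e' \<cdot> f = Zer C A J"
    by (rule adm_monic_cancel[OF m'(2,1) cmp_hom[OF f e'(1)] zer_hom[OF o(1,2)]])
  then obtain e where e: "e \<in> Hom C A I" "m \<cdot> e = f"
    using kernel_lift[OF mk m(1) e'(1) f] by blast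
  have "g \<cdot> m = Zer C I D"
    using cmp_assoc[OF m(1) e'(1) m'(1)] me' m(2) cmp_zer(1)[OF m'(1) o(3)] by simp
  then obtain T' q y where q: "adm_epic E q" "q \<in> Hom C T' I" "y \<in> Hom C T' A" "f \<cdot> y = m \<cdot> q"
    using lift[OF m(1)] by blast
  have "m \<cdot> (e \<cdot> y) = m \<cdot> q" using cmp_pull[OF e(2,1) m(1) q(3)] q(4) by simp
  then have "e \<cdot> y = q" by (rule kernel_monic[OF mk m(1) cmp_hom[OF q(3) e(1)] q(2)])
  then have "adm_epic E e" using adm_epic_of_cmp[OF q(3) e(1)] q(1) by simp
  moreover have "adm_monic E m" using mE by (auto simp: adm_monic_def)
  ultimately have "adm_factorization C E f e m"
    using e m by (simp add: adm_factorization_def Hom_iff)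
  then show ?thesis using em' mE by (auto simp: exact_pair_def)
qed

text \<open>The monic part of \<open>g\<close> can be cancelled, so a kernel of \<open>g\<close> is
  also a kernel of the admissible epic \<open>e\<close>.\<close>

lemma kernel_exact_pair:
  assumes kg: "is_kernel C k g" and ga: "admissible C E g"
  shows "adm_monic E k" "exact_pair C E k g"
proof -
  obtain e m where em: "adm_factorization C E g e m" using ga by (auto simp: admissible_def)
  define K B D where "K = Src C k" "B = Src C g" "D = Tgt C g"
  then have k: "k \<in> Hom C K B" and g: "g \<in> Hom C B D" and gk: "g \<cdot> k = Zer C K D"
    using kernelD[OF kg] by (simp_all add: Hom_iff)
  obtain I where e: "e \<in> Hom C B I" "adm_epic E e" and m: "m \<in> Hom C I D" "adm_monic E m"
    and me: "m \<cdot> e = g"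
    using adm_factorizationE[OF em g] .
  have o: "K \<in> Obj C" "I \<in> Obj C" using k e hom_obj by auto
  have "is_kernel C k e"
  proof (rule kernelI[OF k e(1)])
    have "m \<cdot> (e \<cdot> k) = m \<cdot> Zer C K I"
      using cmp_pull[OF me e(1) m(1) k] gk cmp_zer(1)[OF m(1) o(1)] by simp
    then show "e \<cdot> k = Zer C K I"
      by (rule adm_monic_cancel[OF m(2,1) cmp_hom[OF k e(1)] zer_hom[OF o]])
  next
    fix T x assume x: "x \<in> Hom C T B" and ex: "e \<cdot> x = Zer C T I"
    have T: "T \<in> Obj C" using x hom_obj by auto
    have "g \<cdot> x = Zer C T D"
      using cmp_pull[OF me e(1) m(1) x] ex cmp_zer(1)[OF m(1) T] by simp
    then obtain u where u: "u \<in> Hom C T K" "k \<cdot> u = x" using kernel_lift[OF kg k g x] by blast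
    then show "\<exists>u \<in> Hom C T K. k \<cdot> u = x" by (intro bexI[OF _ u(1)])
  qed (use kernel_monic[OF kg k] in blast)
  then have ke: "(k, e) \<in> E" using adm_epic_kernel[OF e(2)] by blast
  then show k': "adm_monic E k" by (auto simp: adm_monic_def)
  show "exact_pair C E k g"
    using adm_monic_admissible(1)[OF k'] em ke unfolding exact_pair_def by blast
qed

text \<open>Dually, the epic part of \<open>f\<close> can be cancelled, so a cokernel of
  \<open>f\<close> is also a cokernel of the admissible monic \<open>m\<close>.\<close>

lemma cokernel_exact_pair:
  assumes cf: "is_cokernel C c f" and fa: "admissible C E f"
  shows "adm_epic E c" "exact_pair C E f c"
proof -
  obtain e m where em: "adm_factorization C E f e m" using fa by (auto simp: admissible_def)
  define A B D where "A = Src C f" "B = Tgt C f" "D = Tgt C c"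
  then have c: "c \<in> Hom C B D" and f: "f \<in> Hom C A B" and cf0: "c \<cdot> f = Zer C A D"
    using cokernelD[OF cf] by (simp_all add: Hom_iff)
  obtain I where e: "e \<in> Hom C A I" "adm_epic E e" and m: "m \<in> Hom C I B" "adm_monic E m"
    and me: "m \<cdot> e = f"
    using adm_factorizationE[OF em f] .
  have o: "I \<in> Obj C" "D \<in> Obj C" using c e hom_obj by auto
  have "is_cokernel C c m"
  proof (rule cokernelI[OF c m(1)])
    have "(c \<cdot> m) \<cdot> e = Zer C I D \<cdot> e"
      using cmp_assoc[OF e(1) m(1) c] me cf0 cmp_zer(2)[OF e(1) o(2)] by simp
    then show "c \<cdot> m = Zer C I D"
      by (rule adm_epic_cancel[OF e(2,1) cmp_hom[OF m(1) c] zer_hom[OF o]])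
  next
    fix T x assume x: "x \<in> Hom C B T" and xm: "x \<cdot> m = Zer C I T"
    have "x \<cdot> f = Zer C A T" using cmp_pull_zer[OF xm m(1) x e(1)] me by simp
    then obtain u where u: "u \<in> Hom C D T" "u \<cdot> c = x" using cokernel_lift[OF cf c f x] by blast
    then show "\<exists>u \<in> Hom C D T. u \<cdot> c = x" by (intro bexI[OF _ u(1)])
  qed (use cokernel_epic[OF cf c] in blast)
  then have mc: "(m, c) \<in> E" using adm_monic_cokernel[OF m(2)] by blast
  then show c': "adm_epic E c" by (auto simp: adm_epic_def)
  show "exact_pair C E f c"
    using adm_epic_admissible(1)[OF c'] em mc unfolding exact_pair_def by blast
qed

text \<open>Replaces indices by recursion along the list; the head is admissible because it belongs
  to an exact pair.\<close>

lemma exact_sequence_Cons: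
  "exact_sequence C E [f] \<longleftrightarrow> admissible C E f"
  "exact_sequence C E (f # g # fs) \<longleftrightarrow> exact_pair C E f g \<and> exact_sequence C E (g # fs)"
proof -
  show "exact_sequence C E [f] \<longleftrightarrow> admissible C E f" by (simp add: exact_sequence_def)
  have "(\<forall>n. Suc n < length (f # g # fs) \<longrightarrow>
        exact_pair C E ((f # g # fs) ! n) ((f # g # fs) ! Suc n)) \<longleftrightarrow>
      exact_pair C E f g \<and> (\<forall>n. Suc n < length (g # fs) \<longrightarrow>
        exact_pair C E ((g # fs) ! n) ((g # fs) ! Suc n))" (is "(\<forall>n. ?P n) \<longleftrightarrow> ?Q \<and> (\<forall>n. ?R n)")
  proof
    assume "\<forall>n. ?P n"
    then have "?P 0" "\<And>n. ?P (Suc n)" by blast+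
    then show "?Q \<and> (\<forall>n. ?R n)" by simp
  next
    assume *: "?Q \<and> (\<forall>n. ?R n)"
    show "\<forall>n. ?P n"
    proof
      show "?P n" for n using * by (cases n) simp_all
    qed
  qed
  then show "exact_sequence C E (f # g # fs) \<longleftrightarrow>
      exact_pair C E f g \<and> exact_sequence C E (g # fs)"
    unfolding exact_sequence_def using exact_pair_admissible(1)[of f g] by auto
qed

text \<open>For \<open>f = m \<cdot> e\<close>, a kernel of \<open>e\<close> is a kernel of
  \<open>f\<close> and a cokernel of \<open>m\<close> is a cokernel of \<open>f\<close>; both exist
  since \<open>e\<close> and \<open>m\<close> are admissible.\<close>

lemma snake_column_ex:
  assumes fa: "admissible C E f" and f: "f \<in> Hom C A B"
  obtains \<kappa> \<pi> where "snake_column C E \<kappa> f \<pi>"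
proof -
  obtain e m where em: "adm_factorization C E f e m" using fa by (auto simp: admissible_def)
  obtain I where e: "e \<in> Hom C A I" "adm_epic E e" and m: "m \<in> Hom C I B" "adm_monic E m"
    and me: "m \<cdot> e = f"
    using adm_factorizationE[OF em f] .
  obtain K k where k: "k \<in> Hom C K A" "e \<cdot> k = Zer C K I" and ke: "is_kernel C k e"
    using adm_epicE[OF e(2,1)] .
  obtain D c where c: "c \<in> Hom C B D" "c \<cdot> m = Zer C I D" and cm: "is_cokernel C c m"
    using adm_monicE[OF m(2,1)] .
  have o: "K \<in> Obj C" "I \<in> Obj C" "D \<in> Obj C" using k e c hom_obj by auto
  have kf: "is_kernel C k f"
  proof (rule kernelI[OF k(1) f])
    show "f \<cdot> k = Zer C K B"
      using cmp_pull[OF me e(1) m(1) k(1)] k(2) cmp_zer(1)[OF m(1) o(1)] by simp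
  next
    fix T x assume x: "x \<in> Hom C T A" and fx: "f \<cdot> x = Zer C T B"
    have T: "T \<in> Obj C" using x hom_obj by auto
    have "m \<cdot> (e \<cdot> x) = m \<cdot> Zer C T I"
      using cmp_pull[OF me e(1) m(1) x] fx cmp_zer(1)[OF m(1) T] by simp
    then have "e \<cdot> x = Zer C T I"
      by (rule adm_monic_cancel[OF m(2,1) cmp_hom[OF x e(1)] zer_hom[OF T o(2)]])
    then obtain u where u: "u \<in> Hom C T K" "k \<cdot> u = x"
      using kernel_lift[OF ke k(1) e(1) x] by blast
    then show "\<exists>u \<in> Hom C T K. k \<cdot> u = x" by (intro bexI[OF _ u(1)])
  qed (use kernel_monic[OF ke k(1)] in blast)
  have cf: "is_cokernel C c f"
  proof (rule cokernelI[OF c(1) f])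
    show "c \<cdot> f = Zer C A D" using cmp_pull_zer[OF c(2) m(1) c(1) e(1)] me by simp
  next
    fix T x assume x: "x \<in> Hom C B T" and xf: "x \<cdot> f = Zer C A T"
    have T: "T \<in> Obj C" using x hom_obj by auto
    have "(x \<cdot> m) \<cdot> e = Zer C I T \<cdot> e"
      using cmp_assoc[OF e(1) m(1) x] me xf cmp_zer(2)[OF e(1) T] by simp
    then have "x \<cdot> m = Zer C I T"
      by (rule adm_epic_cancel[OF e(2,1) cmp_hom[OF m(1) x] zer_hom[OF o(2) T]])
    then obtain u where u: "u \<in> Hom C D T" "u \<cdot> c = x"
      using cokernel_lift[OF cm c(1) m(1) x] by blast
    then show "\<exists>u \<in> Hom C D T. u \<cdot> c = x" by (intro bexI[OF _ u(1)])
  qed (use cokernel_epic[OF cm c(1)] in blast)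
  show thesis
    using that[of k c] kf cf kernel_exact_pair[OF kf fa] cokernel_exact_pair[OF cf fa]
      adm_epic_admissible(2)
    by (simp add: snake_column_def exact_sequence_Cons)
qed

end

section \<open>The snake\<close>

text \<open>The columns are parameters rather than fields of a \<open>snake\<close> record, so that
  the connecting morphism and the rows can be constructed before there is such a record.\<close>

locale ses_columns = weakly_idempotent_complete_exact_category C E
  for C :: "('o, 'm, 'z) precat_scheme" (structure) and E :: "('m \<times> 'm) set" +
  fixes \<phi> :: "'m ses_map" and m1 m2 m3 c1 c2 c3 :: 'm
  assumes adm: "adm_ses_map C E \<phi>"
    and col1: "snake_column C E m1 (left_map \<phi>) c1"
    and col2: "snake_column C E m2 (mid_map \<phi>) c2"
    and col3: "snake_column C E m3 (right_map \<phi>) c3"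
begin

text \<open>Columns are numbered from left to right by 1, 2, 3; the letters \<open>A\<close>,
  \<open>B\<close>, \<open>K\<close>, \<open>Q\<close> stand for the objects of the upper, lower,
  kernel and cokernel rows.\<close>

abbreviation "i \<equiv> fst (top_seq \<phi>)"
abbreviation "p \<equiv> snd (top_seq \<phi>)"
abbreviation "j \<equiv> fst (bot_seq \<phi>)"
abbreviation "q \<equiv> snd (bot_seq \<phi>)"
abbreviation "f1 \<equiv> left_map \<phi>"
abbreviation "f2 \<equiv> mid_map \<phi>"
abbreviation "f3 \<equiv> right_map \<phi>"
abbreviation "A1 \<equiv> Src C i"
abbreviation "A2 \<equiv> Tgt C i"
abbreviation "A3 \<equiv> Tgt C p"
abbreviation "B1 \<equiv> Src C j"
abbreviation "B2 \<equiv> Tgt C j"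
abbreviation "B3 \<equiv> Tgt C q"
abbreviation "K1 \<equiv> Src C m1"
abbreviation "K2 \<equiv> Src C m2"
abbreviation "K3 \<equiv> Src C m3"
abbreviation "Q1 \<equiv> Tgt C c1"
abbreviation "Q2 \<equiv> Tgt C c2"
abbreviation "Q3 \<equiv> Tgt C c3"

lemma top: "(i, p) \<in> E" and bot: "(j, q) \<in> E"
  using adm by (simp_all add: adm_ses_map_def)

lemma f1: "f1 \<in> Hom C A1 B1" and f2: "f2 \<in> Hom C A2 B2" and f3: "f3 \<in> Hom C A3 B3"
  and left_square: "f2 \<cdot> i = j \<cdot> f1" and right_square: "f3 \<cdot> p = q \<cdot> f2"
  using adm by (simp_all add: adm_ses_map_def pair_morphism_def)

lemma i: "i \<in> Hom C A1 A2" and p: "p \<in> Hom C A2 A3" and pi: "p \<cdot> i = Zer C A1 A3"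
  and i_kernel: "is_kernel C i p"
proof -
  show k: "is_kernel C i p"
    using kernel_cokernel[OF top] by (simp add: kernel_cokernel_pair_def)
  show "i \<in> Hom C A1 A2" "p \<in> Hom C A2 A3" "p \<cdot> i = Zer C A1 A3"
    using kernelD[OF k] by (simp_all add: Hom_iff)
qed

lemma j: "j \<in> Hom C B1 B2" and q: "q \<in> Hom C B2 B3" and qj: "q \<cdot> j = Zer C B1 B3"
  and j_kernel: "is_kernel C j q"
proof -
  show k: "is_kernel C j q"
    using kernel_cokernel[OF bot] by (simp add: kernel_cokernel_pair_def)
  show "j \<in> Hom C B1 B2" "q \<in> Hom C B2 B3" "q \<cdot> j = Zer C B1 B3"
    using kernelD[OF k] by (simp_all add: Hom_iff)
qed

lemma p_epic: "adm_epic E p" and q_epic: "adm_epic E q"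
  unfolding adm_epic_def using top bot by blast+

lemma snake_columnD:
  assumes "snake_column C E k f c" "f \<in> Hom C A B"
  shows "k \<in> Hom C (Src C k) A" "c \<in> Hom C B (Tgt C c)" "f \<cdot> k = Zer C (Src C k) B"
    "c \<cdot> f = Zer C A (Tgt C c)" "is_kernel C k f" "is_cokernel C c f" "adm_epic E c"
    "exact_pair C E f c"
proof -
  show k: "is_kernel C k f" "is_cokernel C c f" "adm_epic E c" "exact_pair C E f c"
    using assms by (simp_all add: snake_column_def exact_sequence_Cons)
  show "k \<in> Hom C (Src C k) A" "c \<in> Hom C B (Tgt C c)" "f \<cdot> k = Zer C (Src C k) B"
    "c \<cdot> f = Zer C A (Tgt C c)"
    using kernelD[OF k(1)] cokernelD[OF k(2)] assms(2) by (simp_all add: Hom_iff)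
qed

lemmas column1 = snake_columnD[OF col1 f1]
lemmas column2 = snake_columnD[OF col2 f2]
lemmas column3 = snake_columnD[OF col3 f3]
lemmas m1 = column1(1) and m2 = column2(1) and m3 = column3(1)
lemmas c1 = column1(2) and c2 = column2(2) and c3 = column3(2)

lemma objs: "A1 \<in> Obj C" "A2 \<in> Obj C" "A3 \<in> Obj C" "B1 \<in> Obj C" "B2 \<in> Obj C" "B3 \<in> Obj C"
  "K1 \<in> Obj C" "K2 \<in> Obj C" "K3 \<in> Obj C" "Q1 \<in> Obj C" "Q2 \<in> Obj C" "Q3 \<in> Obj C"
  using i p j q m1 m2 m3 c1 c2 c3 hom_obj by blast+

text \<open>Under \<open>q\<close> the element \<open>f2 \<cdot> a\<close> becomes
  \<open>f3 \<cdot> m3 \<cdot> x\<close>, which is zero, so it comes from \<open>B1\<close>.\<close>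

lemma lift_bottom:
  assumes a: "a \<in> Hom C T A2" and x: "x \<in> Hom C T K3" and ax: "p \<cdot> a = m3 \<cdot> x"
  obtains b where "b \<in> Hom C T B1" "j \<cdot> b = f2 \<cdot> a"
proof -
  have "q \<cdot> (f2 \<cdot> a) = f3 \<cdot> (p \<cdot> a)" using cmp_square[OF right_square p f3 f2 q a] by simp
  also have "\<dots> = Zer C T B3" using ax cmp_pull_zer[OF column3(3) m3 f3 x] by simp
  finally show thesis using kernel_lift[OF j_kernel j q cmp_hom[OF a f2]] that by blast
qed

text \<open>After restriction to a cover, every element of \<open>K3\<close> admits a zig-zag: lift
  along \<open>p\<close>, apply \<open>f2\<close>, and go back along \<open>j\<close>.\<close>

lemma lift_connecting:
  assumes x: "x \<in> Hom C T K3"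
  obtains P e a b where "adm_epic E e" "e \<in> Hom C P T" "a \<in> Hom C P A2" "b \<in> Hom C P B1"
    "p \<cdot> a = m3 \<cdot> (x \<cdot> e)" "f2 \<cdot> a = j \<cdot> b"
proof -
  obtain P e a where e: "adm_epic E e" "e \<in> Hom C P T" "a \<in> Hom C P A2" "p \<cdot> a = (m3 \<cdot> x) \<cdot> e"
    using lift_epic[OF p_epic p cmp_hom[OF x m3]] .
  have ax: "p \<cdot> a = m3 \<cdot> (x \<cdot> e)" using e(4) cmp_assoc[OF e(2) x m3] by simp
  obtain b where "b \<in> Hom C P B1" "j \<cdot> b = f2 \<cdot> a"
    using lift_bottom[OF e(3) cmp_hom[OF e(2) x] ax] .
  then show thesis using that[OF e(1-3)] ax by simp
qed

text \<open>Quantifying over all zig-zags builds in the independence of choices. It also determines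
  \<open>d\<close> among the arrows from \<open>K3\<close> to \<open>Q1\<close>: the identity of
  \<open>K3\<close> has a zig-zag over some cover, and covers can be cancelled.\<close>

definition connects :: "'m \<Rightarrow> bool" where
  "connects d \<longleftrightarrow> (\<forall>T a x b. a \<in> Hom C T A2 \<longrightarrow> x \<in> Hom C T K3 \<longrightarrow> b \<in> Hom C T B1 \<longrightarrow>
     p \<cdot> a = m3 \<cdot> x \<longrightarrow> f2 \<cdot> a = j \<cdot> b \<longrightarrow> d \<cdot> x = c1 \<cdot> b)"

text \<open>The pull-back \<open>P\<close> of \<open>p\<close> along \<open>m3\<close> carries the
  universal zig-zag \<open>(a, e, b)\<close>. The class \<open>c1 \<cdot> b\<close> vanishes on the
  kernel of \<open>e\<close> and therefore descends along \<open>e\<close> to the connecting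
  morphism.\<close>

lemma connecting_ex:
  obtains d where "d \<in> Hom C K3 Q1" "connects d"
proof -
  have t: "m3 \<in> Arr C" "Tgt C m3 = Tgt C p" "Src C p = A2"
    using m3 p by (simp_all add: Hom_iff)
  obtain e a where ea: "is_pullback C p m3 e a" and ee: "adm_epic E e"
    using epic_pullback[OF p_epic t(1,2)] by blast
  obtain A' B' K' P where "p \<in> Hom C A' B'" "m3 \<in> Hom C K' B'" "e \<in> Hom C P K'"
    "a \<in> Hom C P A'" "m3 \<cdot> e = p \<cdot> a"
    and univ': "\<And>T x y. x \<in> Hom C T K' \<Longrightarrow> y \<in> Hom C T A' \<Longrightarrow> m3 \<cdot> x = p \<cdot> y \<Longrightarrow>
      \<exists>!u. u \<in> Hom C T P \<and> e \<cdot> u = x \<and> a \<cdot> u = y"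
    by (rule pullbackE[OF ea]) blast
  moreover from this have "A' = A2" "K' = K3" using t by (simp_all add: Hom_iff)
  ultimately have e: "e \<in> Hom C P K3" and a: "a \<in> Hom C P A2" and sq: "p \<cdot> a = m3 \<cdot> e"
    and univ: "\<And>T x y. x \<in> Hom C T K3 \<Longrightarrow> y \<in> Hom C T A2 \<Longrightarrow> m3 \<cdot> x = p \<cdot> y \<Longrightarrow>
      \<exists>!u. u \<in> Hom C T P \<and> e \<cdot> u = x \<and> a \<cdot> u = y"
    by simp_all
  obtain b where b: "b \<in> Hom C P B1" "j \<cdot> b = f2 \<cdot> a" using lift_bottom[OF a e sq] .
  obtain N n where n: "n \<in> Hom C N P" "e \<cdot> n = Zer C N K3" and ec: "is_cokernel C e n"
    using adm_epicE[OF ee e] .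
  have N: "N \<in> Obj C" using n hom_obj by auto
  \<comment> \<open>Over the kernel of \<open>e\<close> the lift comes from \<open>A1\<close>, so
    \<open>b\<close> comes from \<open>A1\<close> through \<open>f1\<close> and its class is
    zero.\<close>
  have "p \<cdot> (a \<cdot> n) = Zer C N A3"
    using cmp_square[OF sq a p e m3 n(1)] n(2) cmp_zer(1)[OF m3 N] by simp
  then obtain a' where a': "a' \<in> Hom C N A1" "i \<cdot> a' = a \<cdot> n"
    using kernel_lift[OF i_kernel i p cmp_hom[OF n(1) a]] by blast
  have "j \<cdot> (b \<cdot> n) = f2 \<cdot> (i \<cdot> a')" using cmp_square[OF b(2,1) j a f2 n(1)] a' by simp
  also have "\<dots> = j \<cdot> (f1 \<cdot> a')" using cmp_square[OF left_square i f2 f1 j a'(1)] .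
  finally have bn: "b \<cdot> n = f1 \<cdot> a'"
    by (rule kernel_monic[OF j_kernel j cmp_hom[OF n(1) b(1)] cmp_hom[OF a'(1) f1]])
  have "(c1 \<cdot> b) \<cdot> n = c1 \<cdot> (f1 \<cdot> a')" using cmp_assoc[OF n(1) b(1) c1] bn by simp
  also have "\<dots> = Zer C N Q1" using cmp_pull_zer[OF column1(4) f1 c1 a'(1)] .
  finally obtain d where d: "d \<in> Hom C K3 Q1" "d \<cdot> e = c1 \<cdot> b"
    using cokernel_lift[OF ec e n(1) cmp_hom[OF b(1) c1]] by blast
  have "connects d"
    unfolding connects_def
  proof (intro allI impI)
    fix T a1 x b1
    assume a1: "a1 \<in> Hom C T A2" and x: "x \<in> Hom C T K3" and b1: "b1 \<in> Hom C T B1"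
      and ax: "p \<cdot> a1 = m3 \<cdot> x" and ab: "f2 \<cdot> a1 = j \<cdot> b1"
    \<comment> \<open>Any zig-zag is the restriction along some \<open>u\<close> of the universal
      one; the component in \<open>B1\<close> agrees because \<open>j\<close> is monic.\<close>
    obtain u where u: "u \<in> Hom C T P" "e \<cdot> u = x" "a \<cdot> u = a1"
      using univ[OF x a1] ax by auto
    have "j \<cdot> (b \<cdot> u) = j \<cdot> b1" using cmp_square[OF b(2,1) j a f2 u(1)] u(3) ab by simp
    then have bu: "b \<cdot> u = b1" by (rule kernel_monic[OF j_kernel j cmp_hom[OF u(1) b(1)] b1])
    have "d \<cdot> x = c1 \<cdot> (b \<cdot> u)" using cmp_square[OF d(2) e d(1) b(1) c1 u(1)] u(2) by simp
    then show "d \<cdot> x = c1 \<cdot> b1" using bu by simp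
  qed
  then show thesis using that d by blast
qed

lemma ker_map_ex:
  obtains k where "k \<in> Hom C K1 K2" "m2 \<cdot> k = i \<cdot> m1"
  by (rule kernel_map[OF column2(5) m2 f2 m1 f1 column1(3) i j left_square[symmetric]])

lemma ker_map'_ex:
  obtains k where "k \<in> Hom C K2 K3" "m3 \<cdot> k = p \<cdot> m2"
  by (rule kernel_map[OF column3(5) m3 f3 m2 f2 column2(3) p q right_square[symmetric]])

lemma coker_map_ex:
  obtains c where "c \<in> Hom C Q1 Q2" "c \<cdot> c1 = c2 \<cdot> j"
  by (rule cokernel_map[OF column1(6) c1 f1 c2 f2 column2(4) i j left_square[symmetric]])

lemma coker_map'_ex:
  obtains c where "c \<in> Hom C Q2 Q3" "c \<cdot> c2 = c3 \<cdot> q"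
  by (rule cokernel_map[OF column2(6) c2 f2 c3 f3 column3(4) p q right_square[symmetric]])

end

text \<open>The connecting morphism is assumed only to satisfy \<open>connects\<close>, however it
  was constructed. Exactness and naturality are derived from this alone.\<close>

locale snake = ses_columns C E \<phi> "ker_left S" "ker_mid S" "ker_right S"
    "coker_left S" "coker_mid S" "coker_right S"
  for C :: "('o, 'm, 'z) precat_scheme" (structure) and E :: "('m \<times> 'm) set"
    and \<phi> :: "'m ses_map" and S :: "'m snake" +
  assumes k: "ker_map S \<in> Hom C K1 K2" and k': "ker_map' S \<in> Hom C K2 K3"
    and d: "connecting S \<in> Hom C K3 Q1"
    and c: "coker_map S \<in> Hom C Q1 Q2" and c': "coker_map' S \<in> Hom C Q2 Q3"
    and k_square: "ker_mid S \<cdot> ker_map S = i \<cdot> ker_left S"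
    and k'_square: "ker_right S \<cdot> ker_map' S = p \<cdot> ker_mid S"
    and c_square: "coker_map S \<cdot> coker_left S = coker_mid S \<cdot> j"
    and c'_square: "coker_map' S \<cdot> coker_mid S = coker_right S \<cdot> q"
    and connects: "connects (connecting S)"
begin

abbreviation "m1 \<equiv> ker_left S"
abbreviation "m2 \<equiv> ker_mid S"
abbreviation "m3 \<equiv> ker_right S"
abbreviation "c1 \<equiv> coker_left S"
abbreviation "c2 \<equiv> coker_mid S"
abbreviation "c3 \<equiv> coker_right S"
abbreviation "k \<equiv> ker_map S"
abbreviation "k' \<equiv> ker_map' S"
abbreviation "d \<equiv> connecting S"
abbreviation "c \<equiv> coker_map S"
abbreviation "c' \<equiv> coker_map' S"

section \<open>Exactness of the six-term sequence, from right to left\<close>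

lemma connecting_eq:
  assumes "a \<in> Hom C T A2" "x \<in> Hom C T K3" "b \<in> Hom C T B1" "p \<cdot> a = m3 \<cdot> x" "f2 \<cdot> a = j \<cdot> b"
  shows "d \<cdot> x = c1 \<cdot> b"
  using connects assms unfolding connects_def by blast

lemma cover_trans:
  assumes "adm_epic E e" "e \<in> Hom C T' T" "adm_epic E e'" "e' \<in> Hom C T'' T'"
  shows "adm_epic E (e \<cdot> e')" "e \<cdot> e' \<in> Hom C T'' T"
  using epic_cmp[OF assms(3,1)] cmp_hom[OF assms(4,2)] assms(2,4) by (simp_all add: Hom_iff)

lemma c'_epic: "adm_epic E c'"
proof -
  have "adm_epic E (c3 \<cdot> q)"
    by (rule epic_cmp[OF q_epic column3(7)]) (use q c3 in \<open>simp add: Hom_iff\<close>)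
  then show ?thesis using adm_epic_of_cmp[OF c2 c'] c'_square by simp
qed

text \<open>If \<open>c'\<close> kills the class of \<open>b\<close>, then
  \<open>q \<cdot> b\<close> is locally \<open>f3\<close> of an element of \<open>A3\<close>.
  Lifting that element to \<open>a\<close> and subtracting \<open>f2 \<cdot> a\<close> from
  \<open>b\<close> leaves the class unchanged and moves \<open>b\<close> into the kernel of
  \<open>q\<close>, that is, into \<open>B1\<close>.\<close>

lemma exact_c: "exact_pair C E c c'"
proof (rule exact_pairI[OF c c' adm_epic_admissible(2)[OF c'_epic]])
  have "(c' \<cdot> c) \<cdot> c1 = (c' \<cdot> c2) \<cdot> j"
    using cmp_assoc[OF c1 c c'] cmp_assoc[OF j c2 c'] c_square by simp
  also have "\<dots> = Zer C Q1 Q3 \<cdot> c1"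
    using cmp_assoc[OF j q c3] c'_square qj cmp_zer(1)[OF c3 objs(4)] cmp_zer(2)[OF c1 objs(12)]
    by simp
  finally show "c' \<cdot> c = Zer C Q1 Q3"
    by (rule adm_epic_cancel[OF column1(7) c1 cmp_hom[OF c c'] zer_hom[OF objs(10,12)]])
next
  fix T x assume x: "x \<in> Hom C T Q2" and cx: "c' \<cdot> x = Zer C T Q3"
  obtain T1 e1 b where e1: "adm_epic E e1" "e1 \<in> Hom C T1 T" and b: "b \<in> Hom C T1 B2"
    and bx: "c2 \<cdot> b = x \<cdot> e1"
    using lift_epic[OF column2(7) c2 x] .
  have qb: "q \<cdot> b \<in> Hom C T1 B3" using cmp_hom[OF b q] .
  have "c3 \<cdot> (q \<cdot> b) = c' \<cdot> (x \<cdot> e1)" using cmp_square[OF c'_square c2 c' q c3 b] bx by simp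
  also have "\<dots> = Zer C T1 Q3" using cmp_pull_zer[OF cx x c' e1(2)] .
  finally obtain T2 e2 a3 where e2: "adm_epic E e2" "e2 \<in> Hom C T2 T1"
    and a3: "a3 \<in> Hom C T2 A3" "f3 \<cdot> a3 = (q \<cdot> b) \<cdot> e2"
    using exact_pair_lift[OF column3(8) f3 c3 qb] by blast
  obtain T3 e3 a where e3: "adm_epic E e3" "e3 \<in> Hom C T3 T2"
    and a: "a \<in> Hom C T3 A2" "p \<cdot> a = a3 \<cdot> e3"
    using lift_epic[OF p_epic p a3(1)] .
  define e where "e = e2 \<cdot> e3"
  have e: "adm_epic E e" "e \<in> Hom C T3 T1" unfolding e_def using cover_trans[OF e2 e3] by auto
  have be: "b \<cdot> e \<in> Hom C T3 B2" and fa: "f2 \<cdot> a \<in> Hom C T3 B2"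
    using cmp_hom[OF e(2) b] cmp_hom[OF a(1) f2] .
  have "q \<cdot> (f2 \<cdot> a) = f3 \<cdot> (a3 \<cdot> e3)" using cmp_square[OF right_square p f3 f2 q a(1)] a(2) by simp
  also have "\<dots> = q \<cdot> (b \<cdot> e)"
    using cmp_pull[OF a3(2,1) f3 e3(2)] cmp_assoc[OF e3(2) e2(2) qb] cmp_assoc[OF e(2) b q]
    by (simp add: e_def)
  finally have "q \<cdot> diff (b \<cdot> e) (f2 \<cdot> a) = Zer C T3 B3"
    using cmp_diff_right[OF be fa q] diff_self[OF cmp_hom[OF be q] cmp_hom[OF be q]] by simp
  then obtain b1 where b1: "b1 \<in> Hom C T3 B1" "j \<cdot> b1 = diff (b \<cdot> e) (f2 \<cdot> a)"
    using kernel_lift[OF j_kernel j q diff_hom[OF be fa]] by blast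
  have xe: "x \<cdot> (e1 \<cdot> e) \<in> Hom C T3 Q2" using cmp_hom[OF cmp_hom[OF e(2) e1(2)] x] .
  have "c \<cdot> (c1 \<cdot> b1) = c2 \<cdot> diff (b \<cdot> e) (f2 \<cdot> a)"
    using cmp_square[OF c_square c1 c j c2 b1(1)] b1(2) by simp
  also have "\<dots> = diff (x \<cdot> (e1 \<cdot> e)) (Zer C T3 Q2)"
    using cmp_diff_right[OF be fa c2] cmp_pull[OF bx b c2 e(2)] cmp_assoc[OF e(2) e1(2) x]
      cmp_pull_zer[OF column2(4) f2 c2 a(1)] by simp
  also have "\<dots> = x \<cdot> (e1 \<cdot> e)" using diff_zer_right[OF xe xe] .
  finally show "\<exists>T' e y. adm_epic E e \<and> e \<in> Hom C T' T \<and> y \<in> Hom C T' Q1 \<and> c \<cdot> y = x \<cdot> e"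
    using cover_trans[OF e1 e] cmp_hom[OF b1(1) c1] by blast
qed

text \<open>If \<open>c\<close> kills the class of \<open>b\<close>, then \<open>j \<cdot> b\<close>
  is locally \<open>f2 \<cdot> a\<close>. The image \<open>p \<cdot> a\<close> is killed by
  \<open>f3\<close>, hence comes from some \<open>y\<close> in \<open>K3\<close>, and the zig-zag
  through \<open>a\<close> and \<open>b\<close> computes \<open>d \<cdot> y\<close> as the class of
  \<open>b\<close>.\<close>

lemma exact_d: "exact_pair C E d c"
proof (rule exact_pairI[OF d c exact_pair_admissible(1)[OF exact_c]])
  \<comment> \<open>The composite is evaluated on the universal element of \<open>K3\<close>, its
    identity, which has a zig-zag over a cover \<open>e\<close>.\<close>
  have id3: "Ide C K3 \<in> Hom C K3 K3" using ide_hom[OF objs(9)] .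
  obtain P e a b where e: "adm_epic E e" "e \<in> Hom C P K3" and a: "a \<in> Hom C P A2"
    and b: "b \<in> Hom C P B1" and ae: "p \<cdot> a = m3 \<cdot> (Ide C K3 \<cdot> e)" and ab: "f2 \<cdot> a = j \<cdot> b"
    using lift_connecting[OF id3] .
  have de: "d \<cdot> e = c1 \<cdot> b" using connecting_eq[OF a e(2) b _ ab] ae ide_left[OF e(2)] by simp
  have "(c \<cdot> d) \<cdot> e = c2 \<cdot> (j \<cdot> b)"
    using cmp_assoc[OF e(2) d c] de cmp_square[OF c_square c1 c j c2 b] by simp
  also have "\<dots> = Zer C K3 Q2 \<cdot> e"
    using ab cmp_pull_zer[OF column2(4) f2 c2 a] cmp_zer(2)[OF e(2) objs(11)] by simp
  finally show "c \<cdot> d = Zer C K3 Q2"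
    by (rule adm_epic_cancel[OF e cmp_hom[OF d c] zer_hom[OF objs(9,11)]])
next
  fix T x assume x: "x \<in> Hom C T Q1" and cx: "c \<cdot> x = Zer C T Q2"
  obtain T1 e1 b where e1: "adm_epic E e1" "e1 \<in> Hom C T1 T" and b: "b \<in> Hom C T1 B1"
    and bx: "c1 \<cdot> b = x \<cdot> e1"
    using lift_epic[OF column1(7) c1 x] .
  have jb: "j \<cdot> b \<in> Hom C T1 B2" using cmp_hom[OF b j] .
  have "c2 \<cdot> (j \<cdot> b) = c \<cdot> (x \<cdot> e1)" using cmp_square[OF c_square c1 c j c2 b] bx by simp
  also have "\<dots> = Zer C T1 Q2" using cmp_pull_zer[OF cx x c e1(2)] .
  finally obtain T2 e2 a where e2: "adm_epic E e2" "e2 \<in> Hom C T2 T1"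
    and a: "a \<in> Hom C T2 A2" "f2 \<cdot> a = (j \<cdot> b) \<cdot> e2"
    using exact_pair_lift[OF column2(8) f2 c2 jb] by blast
  have be: "b \<cdot> e2 \<in> Hom C T2 B1" using cmp_hom[OF e2(2) b] .
  have fa: "f2 \<cdot> a = j \<cdot> (b \<cdot> e2)" using a(2) cmp_assoc[OF e2(2) b j] by simp
  have "f3 \<cdot> (p \<cdot> a) = q \<cdot> (j \<cdot> (b \<cdot> e2))"
    using cmp_square[OF right_square p f3 f2 q a(1)] fa by simp
  also have "\<dots> = Zer C T2 B3" using cmp_pull_zer[OF qj j q be] .
  finally obtain y where y: "y \<in> Hom C T2 K3" "m3 \<cdot> y = p \<cdot> a"
    using kernel_lift[OF column3(5) m3 f3 cmp_hom[OF a(1) p]] by blast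
  have "d \<cdot> y = c1 \<cdot> (b \<cdot> e2)" using connecting_eq[OF a(1) y(1) be y(2)[symmetric] fa] .
  also have "\<dots> = x \<cdot> (e1 \<cdot> e2)" using cmp_pull[OF bx b c1 e2(2)] cmp_assoc[OF e2(2) e1(2) x] by simp
  finally show "\<exists>T' e y. adm_epic E e \<and> e \<in> Hom C T' T \<and> y \<in> Hom C T' K3 \<and> d \<cdot> y = x \<cdot> e"
    using cover_trans[OF e1 e2] y(1) by blast
qed

text \<open>If \<open>d \<cdot> x = 0\<close>, then \<open>b\<close> is locally
  \<open>f1 \<cdot> a1\<close>. The corrected lift \<open>a - i \<cdot> a1\<close> still lies over
  \<open>x\<close> and is now killed by \<open>f2\<close>, so it defines an element of
  \<open>K2\<close>.\<close>

lemma exact_k': "exact_pair C E k' d"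
proof (rule exact_pairI[OF k' d exact_pair_admissible(1)[OF exact_d]])
  \<comment> \<open>An element coming from \<open>K2\<close> has \<open>m2\<close> as lift, which
    \<open>f2\<close> kills, so the zig-zag closes with \<open>b = 0\<close>.\<close>
  have z: "Zer C K2 B1 \<in> Hom C K2 B1" using zer_hom[OF objs(8,4)] .
  have "f2 \<cdot> m2 = j \<cdot> Zer C K2 B1" using column2(3) cmp_zer(1)[OF j objs(8)] by simp
  then have "d \<cdot> k' = c1 \<cdot> Zer C K2 B1" by (rule connecting_eq[OF m2 k' z k'_square[symmetric]])
  then show "d \<cdot> k' = Zer C K2 Q1" using cmp_zer(1)[OF c1 objs(8)] by simp
next
  fix T x assume x: "x \<in> Hom C T K3" and dx: "d \<cdot> x = Zer C T Q1"
  obtain T1 e1 a b where e1: "adm_epic E e1" "e1 \<in> Hom C T1 T" and a: "a \<in> Hom C T1 A2"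
    and b: "b \<in> Hom C T1 B1" and ax: "p \<cdot> a = m3 \<cdot> (x \<cdot> e1)" and ab: "f2 \<cdot> a = j \<cdot> b"
    using lift_connecting[OF x] .
  have xe1: "x \<cdot> e1 \<in> Hom C T1 K3" using cmp_hom[OF e1(2) x] .
  have "c1 \<cdot> b = Zer C T1 Q1"
    using connecting_eq[OF a xe1 b ax ab] cmp_pull_zer[OF dx x d e1(2)] by simp
  then obtain T2 e2 a1 where e2: "adm_epic E e2" "e2 \<in> Hom C T2 T1"
    and a1: "a1 \<in> Hom C T2 A1" "f1 \<cdot> a1 = b \<cdot> e2"
    using exact_pair_lift[OF column1(8) f1 c1 b] by blast
  have ae: "a \<cdot> e2 \<in> Hom C T2 A2" and ia: "i \<cdot> a1 \<in> Hom C T2 A2"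
    using cmp_hom[OF e2(2) a] cmp_hom[OF a1(1) i] .
  have "f2 \<cdot> (a \<cdot> e2) = f2 \<cdot> (i \<cdot> a1)"
    using cmp_square[OF ab a f2 b j e2(2)] cmp_square[OF left_square i f2 f1 j a1(1)] a1(2) by simp
  then have "f2 \<cdot> diff (a \<cdot> e2) (i \<cdot> a1) = Zer C T2 B2"
    using cmp_diff_right[OF ae ia f2] diff_self[OF cmp_hom[OF ia f2] cmp_hom[OF ia f2]] by simp
  then obtain y where y: "y \<in> Hom C T2 K2" "m2 \<cdot> y = diff (a \<cdot> e2) (i \<cdot> a1)"
    using kernel_lift[OF column2(5) m2 f2 diff_hom[OF ae ia]] by blast
  have xe: "x \<cdot> (e1 \<cdot> e2) \<in> Hom C T2 K3" using cmp_hom[OF cmp_hom[OF e2(2) e1(2)] x] .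
  have mxe: "m3 \<cdot> (x \<cdot> (e1 \<cdot> e2)) \<in> Hom C T2 A3" using cmp_hom[OF xe m3] .
  have "m3 \<cdot> (k' \<cdot> y) = p \<cdot> diff (a \<cdot> e2) (i \<cdot> a1)"
    using cmp_square[OF k'_square k' m3 m2 p y(1)] y(2) by simp
  also have "\<dots> = diff (m3 \<cdot> (x \<cdot> (e1 \<cdot> e2))) (Zer C T2 A3)"
    using cmp_diff_right[OF ae ia p] cmp_square[OF ax a p xe1 m3 e2(2)]
      cmp_assoc[OF e2(2) e1(2) x] cmp_pull_zer[OF pi i p a1(1)] by simp
  also have "\<dots> = m3 \<cdot> (x \<cdot> (e1 \<cdot> e2))" using diff_zer_right[OF mxe mxe] .
  finally have "k' \<cdot> y = x \<cdot> (e1 \<cdot> e2)"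
    by (rule kernel_monic[OF column3(5) m3 cmp_hom[OF y(1) k'] xe])
  then show "\<exists>T' e y. adm_epic E e \<and> e \<in> Hom C T' T \<and> y \<in> Hom C T' K2 \<and> k' \<cdot> y = x \<cdot> e"
    using cover_trans[OF e1 e2] y(1) by blast
qed

text \<open>All lifts in this chase are along kernels and hence exist without passing to a cover, so
  \<open>k\<close> is an actual kernel of \<open>k'\<close>. As \<open>k'\<close> is admissible by
  \<open>exact_k'\<close>, it follows that \<open>k\<close> is an admissible monic.\<close>

lemma k_kernel: "is_kernel C k k'"
proof (rule kernelI[OF k k'])
  have "m3 \<cdot> (k' \<cdot> k) = p \<cdot> (i \<cdot> m1)" using cmp_square[OF k'_square k' m3 m2 p k] k_square by simp
  also have "\<dots> = m3 \<cdot> Zer C K1 K3" using cmp_pull_zer[OF pi i p m1] cmp_zer(1)[OF m3 objs(7)] by simp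
  finally show "k' \<cdot> k = Zer C K1 K3"
    by (rule kernel_monic[OF column3(5) m3 cmp_hom[OF k k'] zer_hom[OF objs(7,9)]])
next
  fix T x assume x: "x \<in> Hom C T K2" and kx: "k' \<cdot> x = Zer C T K3"
  have T: "T \<in> Obj C" using x hom_obj by auto
  have "p \<cdot> (m2 \<cdot> x) = Zer C T A3"
    using cmp_square[OF k'_square k' m3 m2 p x] kx cmp_zer(1)[OF m3 T] by simp
  then obtain a where a: "a \<in> Hom C T A1" "i \<cdot> a = m2 \<cdot> x"
    using kernel_lift[OF i_kernel i p cmp_hom[OF x m2]] by blast
  have "j \<cdot> (f1 \<cdot> a) = f2 \<cdot> (m2 \<cdot> x)" using cmp_square[OF left_square i f2 f1 j a(1)] a(2) by simp
  also have "\<dots> = j \<cdot> Zer C T B1"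
    using cmp_pull_zer[OF column2(3) m2 f2 x] cmp_zer(1)[OF j T] by simp
  finally have "f1 \<cdot> a = Zer C T B1"
    by (rule kernel_monic[OF j_kernel j cmp_hom[OF a(1) f1] zer_hom[OF T objs(4)]])
  then obtain y where y: "y \<in> Hom C T K1" "m1 \<cdot> y = a"
    using kernel_lift[OF column1(5) m1 f1 a(1)] by blast
  have "m2 \<cdot> (k \<cdot> y) = m2 \<cdot> x" using cmp_square[OF k_square k m2 m1 i y(1)] y(2) a(2) by simp
  then have "k \<cdot> y = x" by (rule kernel_monic[OF column2(5) m2 cmp_hom[OF y(1) k] x])
  then show "\<exists>y \<in> Hom C T K1. k \<cdot> y = x" by (intro bexI[OF _ y(1)])
next
  fix T u v assume u: "u \<in> Hom C T K1" and v: "v \<in> Hom C T K1" and uv: "k \<cdot> u = k \<cdot> v"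
  have "i \<cdot> (m1 \<cdot> u) = i \<cdot> (m1 \<cdot> v)"
    using cmp_square[OF k_square k m2 m1 i u] cmp_square[OF k_square k m2 m1 i v] uv by simp
  then have "m1 \<cdot> u = m1 \<cdot> v"
    by (rule kernel_monic[OF i_kernel i cmp_hom[OF u m1] cmp_hom[OF v m1]])
  then show "u = v" by (rule kernel_monic[OF column1(5) m1 u v])
qed

lemmas exact_k = kernel_exact_pair[OF k_kernel exact_pair_admissible(1)[OF exact_k']]

lemma snake_sequence: "snake_sequence C E S"
  using d exact_k exact_k' exact_d exact_c c'_epic adm_epic_admissible(2)[OF c'_epic]
  by (simp add: snake_sequence_def exact_sequence_Cons)

lemma snake_diagram: "snake_diagram C E \<phi> S"
proof -
  have s: "Src C k = K1" "Tgt C k = K2" "Tgt C k' = K3" "Src C c = Q1" "Tgt C c = Q2"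
    "Tgt C c' = Q3"
    using k k' c c' by (simp_all add: Hom_iff)
  have "pair_morphism C (ker_row S) (top_seq \<phi>) m1 m2 m3"
    using m1 m2 m3 k_square k'_square by (simp add: pair_morphism_def ker_row_def s)
  moreover have "pair_morphism C (bot_seq \<phi>) (coker_row S) c1 c2 c3"
    using c1 c2 c3 c_square c'_square by (simp add: pair_morphism_def coker_row_def s)
  ultimately show ?thesis
    using col1 col2 col3 k k' c c' exact_k(2) exact_c exact_pair_admissible(2)[OF exact_k(2)]
      exact_pair_admissible(2)[OF exact_c]
    by (simp add: snake_diagram_def exact_sequence_Cons)
qed

end

section \<open>Existence and naturality of snakes\<close>

context weakly_idempotent_complete_exact_category
begin

lemma snake_ex:
  assumes adm: "adm_ses_map C E \<phi>"
  obtains S where "snake C E \<phi> S"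
proof -
  have "admissible C E (left_map \<phi>)" "admissible C E (mid_map \<phi>)" "admissible C E (right_map \<phi>)"
    using adm by (simp_all add: adm_ses_map_def)
  moreover have "left_map \<phi> \<in> Hom C (Src C (fst (top_seq \<phi>))) (Src C (fst (bot_seq \<phi>)))"
    "mid_map \<phi> \<in> Hom C (Tgt C (fst (top_seq \<phi>))) (Tgt C (fst (bot_seq \<phi>)))"
    "right_map \<phi> \<in> Hom C (Tgt C (snd (top_seq \<phi>))) (Tgt C (snd (bot_seq \<phi>)))"
    using adm by (simp_all add: adm_ses_map_def pair_morphism_def)
  ultimately obtain m1 c1 m2 c2 m3 c3 where col: "snake_column C E m1 (left_map \<phi>) c1"
    "snake_column C E m2 (mid_map \<phi>) c2" "snake_column C E m3 (right_map \<phi>) c3"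
    by (meson snake_column_ex)
  interpret ses_columns C E \<phi> m1 m2 m3 c1 c2 c3 using adm col by unfold_locales
  obtain k where k: "k \<in> Hom C K1 K2" "m2 \<cdot> k = i \<cdot> m1" using ker_map_ex .
  obtain k' where k': "k' \<in> Hom C K2 K3" "m3 \<cdot> k' = p \<cdot> m2" using ker_map'_ex .
  obtain c where c: "c \<in> Hom C Q1 Q2" "c \<cdot> c1 = c2 \<cdot> j" using coker_map_ex .
  obtain c' where c': "c' \<in> Hom C Q2 Q3" "c' \<cdot> c2 = c3 \<cdot> q" using coker_map'_ex .
  obtain d where d: "d \<in> Hom C K3 Q1" "connects d" using connecting_ex .
  have "snake C E \<phi> \<lparr>ker_left = m1, ker_mid = m2, ker_right = m3, coker_left = c1, coker_mid = c2,
      coker_right = c3, ker_map = k, ker_map' = k', connecting = d, coker_map = c, coker_map' = c'\<rparr>"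
    by unfold_locales (simp_all add: adm col k k' c c' d)
  then show thesis by (rule that)
qed

text \<open>The maps on kernels and cokernels are induced, and their squares are checked after
  composing with a kernel \<open>T.m2\<close>, \<open>T.m3\<close> or after precomposing with a
  cokernel \<open>S.c1\<close>, \<open>S.c2\<close>. The square of connecting morphisms holds
  because the given morphism carries zig-zags to zig-zags.\<close>

lemma snake_naturality:
  assumes S: "snake C E \<phi> S" and T: "snake C E \<psi> T"
    and mor: "ses_map_morphism C \<phi> \<psi> a1 a2 a3 b1 b2 b3"
  shows "snake_natural C S T a1 a2 a3 b1 b2 b3"
proof -
  interpret S: snake C E \<phi> S by (rule S)
  interpret T: snake C E \<psi> T by (rule T)
  have a1: "a1 \<in> Hom C S.A1 T.A1" and a2: "a2 \<in> Hom C S.A2 T.A2" and a3: "a3 \<in> Hom C S.A3 T.A3"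
    and ai: "a2 \<cdot> S.i = T.i \<cdot> a1" and ap: "a3 \<cdot> S.p = T.p \<cdot> a2"
    and b1: "b1 \<in> Hom C S.B1 T.B1" and b2: "b2 \<in> Hom C S.B2 T.B2" and b3: "b3 \<in> Hom C S.B3 T.B3"
    and bj: "b2 \<cdot> S.j = T.j \<cdot> b1" and bq: "b3 \<cdot> S.q = T.q \<cdot> b2"
    and sq1: "b1 \<cdot> S.f1 = T.f1 \<cdot> a1" and sq2: "b2 \<cdot> S.f2 = T.f2 \<cdot> a2"
    and sq3: "b3 \<cdot> S.f3 = T.f3 \<cdot> a3"
    using mor by (simp_all add: ses_map_morphism_def pair_morphism_def)
  obtain u1 where u1: "u1 \<in> Hom C S.K1 T.K1" "T.m1 \<cdot> u1 = a1 \<cdot> S.m1"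
    by (rule kernel_map[OF T.column1(5) T.m1 T.f1 S.m1 S.f1 S.column1(3) a1 b1 sq1])
  obtain u2 where u2: "u2 \<in> Hom C S.K2 T.K2" "T.m2 \<cdot> u2 = a2 \<cdot> S.m2"
    by (rule kernel_map[OF T.column2(5) T.m2 T.f2 S.m2 S.f2 S.column2(3) a2 b2 sq2])
  obtain u3 where u3: "u3 \<in> Hom C S.K3 T.K3" "T.m3 \<cdot> u3 = a3 \<cdot> S.m3"
    by (rule kernel_map[OF T.column3(5) T.m3 T.f3 S.m3 S.f3 S.column3(3) a3 b3 sq3])
  obtain v1 where v1: "v1 \<in> Hom C S.Q1 T.Q1" "v1 \<cdot> S.c1 = T.c1 \<cdot> b1"
    by (rule cokernel_map[OF S.column1(6) S.c1 S.f1 T.c1 T.f1 T.column1(4) a1 b1 sq1])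
  obtain v2 where v2: "v2 \<in> Hom C S.Q2 T.Q2" "v2 \<cdot> S.c2 = T.c2 \<cdot> b2"
    by (rule cokernel_map[OF S.column2(6) S.c2 S.f2 T.c2 T.f2 T.column2(4) a2 b2 sq2])
  obtain v3 where v3: "v3 \<in> Hom C S.Q3 T.Q3" "v3 \<cdot> S.c3 = T.c3 \<cdot> b3"
    by (rule cokernel_map[OF S.column3(6) S.c3 S.f3 T.c3 T.f3 T.column3(4) a3 b3 sq3])
  have "T.m2 \<cdot> (u2 \<cdot> S.k) = a2 \<cdot> (S.i \<cdot> S.m1)"
    using cmp_square[OF u2(2,1) T.m2 S.m2 a2 S.k] S.k_square by simp
  also have "\<dots> = T.i \<cdot> (T.m1 \<cdot> u1)" using cmp_square[OF ai S.i a2 a1 T.i S.m1] u1(2) by simp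
  also have "\<dots> = T.m2 \<cdot> (T.k \<cdot> u1)" using cmp_square[OF T.k_square T.k T.m2 T.m1 T.i u1(1)] by simp
  finally have k: "u2 \<cdot> S.k = T.k \<cdot> u1"
    by (rule kernel_monic[OF T.column2(5) T.m2 cmp_hom[OF S.k u2(1)] cmp_hom[OF u1(1) T.k]])
  have "T.m3 \<cdot> (u3 \<cdot> S.k') = a3 \<cdot> (S.p \<cdot> S.m2)"
    using cmp_square[OF u3(2,1) T.m3 S.m3 a3 S.k'] S.k'_square by simp
  also have "\<dots> = T.p \<cdot> (T.m2 \<cdot> u2)" using cmp_square[OF ap S.p a3 a2 T.p S.m2] u2(2) by simp
  also have "\<dots> = T.m3 \<cdot> (T.k' \<cdot> u2)"
    using cmp_square[OF T.k'_square T.k' T.m3 T.m2 T.p u2(1)] by simp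
  finally have k': "u3 \<cdot> S.k' = T.k' \<cdot> u2"
    by (rule kernel_monic[OF T.column3(5) T.m3 cmp_hom[OF S.k' u3(1)] cmp_hom[OF u2(1) T.k']])
  have "(v2 \<cdot> S.c) \<cdot> S.c1 = T.c2 \<cdot> (b2 \<cdot> S.j)"
    using cmp_assoc[OF S.c1 S.c v2(1)] S.c_square cmp_square[OF v2(2) S.c2 v2(1) b2 T.c2 S.j] by simp
  also have "\<dots> = T.c \<cdot> (T.c1 \<cdot> b1)"
    using bj cmp_square[OF T.c_square T.c1 T.c T.j T.c2 b1] by simp
  also have "\<dots> = (T.c \<cdot> v1) \<cdot> S.c1" using cmp_assoc[OF S.c1 v1(1) T.c] v1(2) by simp
  finally have c: "v2 \<cdot> S.c = T.c \<cdot> v1"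
    by (rule adm_epic_cancel[OF S.column1(7) S.c1 cmp_hom[OF S.c v2(1)] cmp_hom[OF v1(1) T.c]])
  have "(v3 \<cdot> S.c') \<cdot> S.c2 = T.c3 \<cdot> (b3 \<cdot> S.q)"
    using cmp_assoc[OF S.c2 S.c' v3(1)] S.c'_square cmp_square[OF v3(2) S.c3 v3(1) b3 T.c3 S.q]
    by simp
  also have "\<dots> = T.c' \<cdot> (T.c2 \<cdot> b2)"
    using bq cmp_square[OF T.c'_square T.c2 T.c' T.q T.c3 b2] by simp
  also have "\<dots> = (T.c' \<cdot> v2) \<cdot> S.c2" using cmp_assoc[OF S.c2 v2(1) T.c'] v2(2) by simp
  finally have c': "v3 \<cdot> S.c' = T.c' \<cdot> v2"
    by (rule adm_epic_cancel[OF S.column2(7) S.c2 cmp_hom[OF S.c' v3(1)] cmp_hom[OF v2(1) T.c']])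
  \<comment> \<open>A zig-zag of \<open>S\<close> for the identity of \<open>S.K3\<close>; its cover
    \<open>e\<close> is cancelled at the end.\<close>
  obtain P e a b where e: "adm_epic E e" "e \<in> Hom C P S.K3" and a: "a \<in> Hom C P S.A2"
    and b: "b \<in> Hom C P S.B1" and ae: "S.p \<cdot> a = S.m3 \<cdot> (Ide C S.K3 \<cdot> e)" and ab: "S.f2 \<cdot> a = S.j \<cdot> b"
    using S.lift_connecting[OF ide_hom[OF S.objs(9)]] .
  have ae: "S.p \<cdot> a = S.m3 \<cdot> e" using ae ide_left[OF e(2)] by simp
  \<comment> \<open>The images under \<open>a2\<close>, \<open>u3\<close> and \<open>b1\<close> form
    a zig-zag of \<open>T\<close>, which evaluates \<open>T.d\<close> by
    \<open>T.connecting_eq\<close>.\<close>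
  have "T.p \<cdot> (a2 \<cdot> a) = T.m3 \<cdot> (u3 \<cdot> e)"
    using cmp_square[OF ap S.p a3 a2 T.p a] ae cmp_square[OF u3(2,1) T.m3 S.m3 a3 e(2)] by simp
  moreover have "T.f2 \<cdot> (a2 \<cdot> a) = T.j \<cdot> (b1 \<cdot> b)"
    using cmp_square[OF sq2 S.f2 b2 a2 T.f2 a] ab cmp_square[OF bj S.j b2 b1 T.j b] by simp
  ultimately have "T.d \<cdot> (u3 \<cdot> e) = T.c1 \<cdot> (b1 \<cdot> b)"
    by (rule T.connecting_eq[OF cmp_hom[OF a a2] cmp_hom[OF e(2) u3(1)] cmp_hom[OF b b1]])
  moreover have "(v1 \<cdot> S.d) \<cdot> e = T.c1 \<cdot> (b1 \<cdot> b)"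
    using cmp_assoc[OF e(2) S.d v1(1)] S.connecting_eq[OF a e(2) b ae ab]
      cmp_square[OF v1(2) S.c1 v1(1) b1 T.c1 b] by simp
  ultimately have "(v1 \<cdot> S.d) \<cdot> e = (T.d \<cdot> u3) \<cdot> e" using cmp_assoc[OF e(2) u3(1) T.d] by simp
  then have d: "v1 \<cdot> S.d = T.d \<cdot> u3"
    by (rule adm_epic_cancel[OF e cmp_hom[OF S.d v1(1)] cmp_hom[OF u3(1) T.d]])
  have objs: "Src C S.k = S.K1" "Tgt C S.k = S.K2" "Tgt C S.k' = S.K3" "Src C S.c = S.Q1"
    "Tgt C S.c = S.Q2" "Tgt C S.c' = S.Q3" "Src C T.k = T.K1" "Tgt C T.k = T.K2"
    "Tgt C T.k' = T.K3" "Src C T.c = T.Q1" "Tgt C T.c = T.Q2" "Tgt C T.c' = T.Q3"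
    using S.k S.k' S.c S.c' T.k T.k' T.c T.c' by (simp_all add: Hom_iff)
  have "pair_morphism C (ker_row S) (ker_row T) u1 u2 u3"
    using u1(1) u2(1) u3(1) k k' by (simp add: pair_morphism_def ker_row_def objs)
  moreover have "pair_morphism C (coker_row S) (coker_row T) v1 v2 v3"
    using v1(1) v2(1) v3(1) c c' by (simp add: pair_morphism_def coker_row_def objs)
  ultimately show ?thesis
    unfolding snake_natural_def using u1(2) u2(2) u3(2) v1(2) v2(2) v3(2) d by blast
qed

end

theorem corollary8p13:
  fixes C :: "('o, 'm, 'z) precat_scheme" and E :: "('m \<times> 'm) set"
  assumes "exact_category C E"
    and "weakly_idempotent_complete C"
  shows "\<exists>S :: 'm ses_map \<Rightarrow> 'm snake.
    (\<forall>\<phi>. adm_ses_map C E \<phi> \<longrightarrow>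
       snake_diagram C E \<phi> (S \<phi>) \<and> snake_sequence C E (S \<phi>)) \<and>
    (\<forall>\<phi> \<psi> a' a a'' b' b b''.
       adm_ses_map C E \<phi> \<longrightarrow> adm_ses_map C E \<psi> \<longrightarrow>
       ses_map_morphism C \<phi> \<psi> a' a a'' b' b b'' \<longrightarrow>
       snake_natural C (S \<phi>) (S \<psi>) a' a a'' b' b b'')"
proof -
  interpret weakly_idempotent_complete_exact_category C E
    using assms by (simp add: weakly_idempotent_complete_exact_category_def
        weakly_idempotent_complete_exact_category_axioms_def)
  \<comment> \<open>An arbitrary choice for each \<open>\<phi>\<close> is enough, because
    \<open>snake_naturality\<close> holds between any two snakes over the given morphisms.\<close>
  define S where "S \<phi> = (SOME S. snake C E \<phi> S)" for \<phi>
  have S: "snake C E \<phi> (S \<phi>)" if "adm_ses_map C E \<phi>" for \<phi>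
    unfolding S_def by (rule snake_ex[OF that]) (rule someI)
  show ?thesis
    using snake.snake_diagram[OF S] snake.snake_sequence[OF S] snake_naturality[OF S S]
    by (intro exI[of _ S]) simp
qed

end
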